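(* Let $X\subset\mathbb{R}^n$ ($n\ge 2$), $\sigma$, $k$, $\rho$, the isotropic source $S$, the solution $v_0$ of the adjoint equation, the internal functional $H_{v_0}$ and the operators $\mathcal{M}_{v_0},\mathcal{K}_{v_0},\mathcal{S}$ be as defined in the context, under the standing assumptions stated there (in particular (A1) and (A2)). Suppose that $\operatorname{diam}(X)\,\rho<1$ and $$ \frac{\|v_0\|_{C(X)}\,\big(\|\sigma\|_{C(X)}+\rho\big)\,\operatorname{diam}(X)\,\operatorname{Vol}(\mathbb{S}^{n-1})}{\big(1-\operatorname{diam}(X)\rho\big)\,\inf_{x\in\overline{X}}\left(\int_{\mathbb{S}^{n-1}}v_0(x,\theta)\,d\theta\right)}<1 . $$ Then the operator $\mathcal{M}_{v_0}\circ\mathcal{K}_{v_0}\circ\mathcal{S}:C(X)\to C(X)$ is a contraction, and the source $S$ can be computed from the Neumann series $$ S=\sum_{j=0}^{\infty}\big(-\mathcal{M}_{v_0}\circ\mathcal{K}_{v_0}\circ\mathcal{S}\big)^j\big(\mathcal{M}_{v_0}[H_{v_0}]\big). $$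
   Context: **Domain.** $X\subset\mathbb{R}^n$, $n\ge2$, is a bounded open set with smooth boundary and unit outer normal $n(x)$; $\Gamma_\pm=\{(x,\theta)\in\partial X\times\mathbb{S}^{n-1}:\ \pm\theta\cdot n(x)>0\}$; $\operatorname{diam}(X)=\sup\{|x-y|:x,y\in X\}$; $\operatorname{Vol}(\mathbb{S}^{n-1})$ is the surface measure of the sphere. **Norms.** $\|\cdot\|_{C(X)}$ is the supremum norm on (bounded) continuous functions on $X$; for a function $v(x,\theta)$, $\|v\|_{C(X)}$ denotes the supremum of $|v|$ over $X\times\mathbb{S}^{n-1}$. For $1\le p\le\infty$, $\|u\|_{L^p(\mathbb{S}^{n-1},C(X))}=\left(\int_{\mathbb{S}^{n-1}}\|u(\cdot,\theta)\|_{C(X)}^p\,d\theta\right)^{1/p}$ (usual modification for $p=\infty$), and $L^p(\mathbb{S}^{n-1},C(X))$ is the corresponding space. "Contraction" means operator norm strictly less than $1$. **Standing assumptions.** $\sigma=\sigma(x)$ is the attenuation coefficient and $k=k(x,\theta,\theta')$ the scattering kernel; both are uniformly positive. $k$ is rotation invariant: $k(x,\theta,\theta')=k(x,\theta\cdot\theta')$. - (A1) $\sigma$, $k$ and $S$ are continuous on $\overline{X}$. - (A2) With $\rho=\left\|\int_{\mathbb{S}^{n-1}}k(x,\theta,\theta')\,d\theta'\right\|_{L^\infty(X\times\mathbb{S}^{n-1})}$, either $\left(\inf_{\overline X}\sigma\right)-\rho\ge\alpha$ for some constant $\alpha>0$, or $\operatorname{diam}(X)\rho<1$. **Forward problem.**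 For an isotropic source $S=S(x)$ (independent of $\theta$), $u=u(x,\theta)$ denotes the unique solution of the radiative transfer equation $$\theta\cdot\nabla u+\sigma(x)u-\int_{\mathbb{S}^{n-1}}k(x,\theta,\theta')u(x,\theta')\,d\theta'=S(x)\ \text{ in }X\times\mathbb{S}^{n-1},\qquad u|_{\Gamma_-}=0.$$ **Adjoint solution.** $v_0$ is a continuous solution of $$-\theta\cdot\nabla v_0+\sigma v_0-\int_{\mathbb{S}^{n-1}}k(x,\theta,\theta')v_0(x,\theta')\,d\theta'=0,\qquad v_0|_{\Gamma_+}=f_0,$$ where $f_0\in C(\Gamma_+)$ is uniformly positive, such that for some constant $c>0$ one has $v_0(x,\theta)\ge c$ and $\int_{\mathbb{S}^{n-1}}v_0(x,\theta)\,d\theta\ge c$ for all $(x,\theta)\in X\times\mathbb{S}^{n-1}$. **Internal functional.** With $u$ the forward solution for the source $S$, $$H_{v_0}(x)=-\int_{\mathbb{S}^{n-1}}\sigma u v_0\,d\theta+\int_{\mathbb{S}^{n-1}}v_0S\,d\theta+\int_{\mathbb{S}^{n-1}}\int_{\mathbb{S}^{n-1}}k(x,\theta,\theta')v_0(x,\theta)u(x,\theta')\,d\theta'\,d\theta .$$ **Operators.** $\mathcal{A}u(x,\theta)=-\sigma(x)u(x,\theta)+\int_{\mathbb{S}^{n-1}}k(x,\theta,\theta')u(x,\theta')\,d\theta'$. Fix $1\le p\le\infty$. - $\mathcal{S}:C(X)\to L^p(\mathbb{S}^{n-1},C(X))$ maps a source $S$ to the forward solution $u$. - $\mathcal{K}_{v_0}:L^p(\mathbb{S}^{n-1},C(X))\to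 C(X)$, $\mathcal{K}_{v_0}u(x)=\int_{\mathbb{S}^{n-1}}\mathcal{A}u(x,\theta)\,v_0(x,\theta)\,d\theta$. - $\mathcal{M}_{v_0}:C(X)\to C(X)$, $\mathcal{M}_{v_0}f(x)=f(x)\big/\int_{\mathbb{S}^{n-1}}v_0(x,\theta)\,d\theta$. *)

theory Defs
  imports "HOL-Analysis.Analysis"
begin

section \<open>Smooth domains and the boundary sets\<close>

primrec Ck_on :: "nat \<Rightarrow> (real^'n) set \<Rightarrow> (real^'n \<Rightarrow> real) \<Rightarrow> bool" where
  "Ck_on 0 U f \<longleftrightarrow> continuous_on U f"
| "Ck_on (Suc m) U f \<longleftrightarrow> f differentiable_on U \<and>
     (\<forall>i\<in>Basis. Ck_on m U (\<lambda>x. frechet_derivative f (at x) i))"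

definition smooth_on :: "(real^'n) set \<Rightarrow> (real^'n \<Rightarrow> real) \<Rightarrow> bool" where
  "smooth_on U f \<longleftrightarrow> (\<forall>m. Ck_on m U f)"

definition local_defining_function ::
  "(real^'n) set \<Rightarrow> real^'n \<Rightarrow> (real^'n) set \<Rightarrow> (real^'n \<Rightarrow> real) \<Rightarrow> bool" where
  "local_defining_function X y U \<phi> \<longleftrightarrow>
     open U \<and> y \<in> U \<and> smooth_on U \<phi> \<and>
     (\<forall>z\<in>U. \<exists>g. GDERIV \<phi> z :> g \<and> g \<noteq> 0) \<and>
     X \<inter> U = {z\<in>U. \<phi> z < 0}"

definition smooth_boundary :: "(real^'n) set \<Rightarrow> bool" where
  "smooth_boundary X \<longleftrightarrow> (\<forall>y\<in>frontier X. \<exists>U \<phi>. local_defining_function X y U \<phi>)"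

text \<open>The direction of the gradient does not depend on the defining function, so the
  description is unique at every boundary point of a domain with smooth boundary.\<close>

definition outer_normal :: "(real^'n) set \<Rightarrow> real^'n \<Rightarrow> real^'n" where
  "outer_normal X y =
     (THE \<nu>. \<exists>U \<phi> g. local_defining_function X y U \<phi> \<and> GDERIV \<phi> y :> g \<and> \<nu> = sgn g)"

abbreviation usphere :: "(real^'n) set" where
  "usphere \<equiv> sphere 0 1"

definition Gamma_plus :: "(real^'n) set \<Rightarrow> ((real^'n) \<times> (real^'n)) set" where
  "Gamma_plus X = {(y, \<theta>). y \<in> frontier X \<and> \<theta> \<in> usphere \<and> \<theta> \<bullet> outer_normal X y > 0}"

definition Gamma_minus :: "(real^'n) set \<Rightarrow> ((real^'n) \<times> (real^'n)) set" where
  "Gamma_minus X = {(y, \<theta>). y \<in> frontier X \<and> \<theta> \<in> usphere \<and> \<theta> \<bullet> outer_normal X y < 0}"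

section \<open>Surface measure and norms\<close>

text \<open>The measure of a Borel set \<open>A\<close> of directions is \<open>n\<close> times the volume of the part of the
  unit ball lying over \<open>A\<close>. By integration in polar coordinates this is the surface measure
  of the unit sphere. Here \<open>sgn x = x / norm x\<close>.\<close>

definition sphere_measure :: "(real^'n) measure" where
  "sphere_measure = scale_measure (of_nat CARD('n))
     (distr (restrict_space lborel (ball 0 1 - {0})) (restrict_space borel usphere) sgn)"

definition Cb :: "'a::topological_space set \<Rightarrow> ('a \<Rightarrow> real) set" where
  "Cb A = {f. continuous_on A f \<and> bounded (f ` A)}"

definition sup_norm :: "'a set \<Rightarrow> ('a \<Rightarrow> real) \<Rightarrow> real" where
  "sup_norm A f = (SUP z\<in>A. \<bar>f z\<bar>)"

definition Linf_norm :: "'a measure \<Rightarrow> ('a \<Rightarrow> real) \<Rightarrow> real" where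
  "Linf_norm M f = Inf {C. 0 \<le> C \<and> (AE z in M. \<bar>f z\<bar> \<le> C)}"

text \<open>Membership in \<open>L\<^sup>p(S, C(X))\<close>, \<open>S\<close> the unit sphere, for \<open>1 \<le> p \<le> \<infinity>\<close>. Elements are
  represented by functions of \<open>x\<close> and \<open>\<theta>\<close>, and what happens for a null set of \<open>\<theta>\<close>
  is irrelevant up to measurability of each \<open>u x\<close>.\<close>

definition LpC :: "ennreal \<Rightarrow> (real^'n) set \<Rightarrow> (real^'n \<Rightarrow> real^'n \<Rightarrow> real) set" where
  "LpC p X = {u. (\<forall>x\<in>X. u x \<in> borel_measurable sphere_measure) \<and>
     (AE \<theta> in sphere_measure. (\<lambda>x. u x \<theta>) \<in> Cb X) \<and>
     (if p = \<infinity> then \<exists>C. AE \<theta> in sphere_measure. sup_norm X (\<lambda>x. u x \<theta>) \<le> C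
      else (\<integral>\<^sup>+\<theta>. ennreal (sup_norm X (\<lambda>x. u x \<theta>) powr enn2real p) \<partial>sphere_measure) < \<infinity>)}"

text \<open>Operators on \<open>C(X)\<close> act on functions on the whole space; only the values on \<open>X\<close> matter.\<close>

definition op_norm_C :: "(real^'n) set \<Rightarrow> ((real^'n \<Rightarrow> real) \<Rightarrow> real^'n \<Rightarrow> real) \<Rightarrow> ereal" where
  "op_norm_C X T = (SUP f\<in>{f\<in>Cb X. sup_norm X f \<le> 1}. ereal (sup_norm X (T f)))"

definition contraction_C :: "(real^'n) set \<Rightarrow> ((real^'n \<Rightarrow> real) \<Rightarrow> real^'n \<Rightarrow> real) \<Rightarrow> bool" where
  "contraction_C X T \<longleftrightarrow>
     (\<forall>f\<in>Cb X. T f \<in> Cb X) \<and>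
     (\<forall>f\<in>Cb X. \<forall>g\<in>Cb X. \<forall>a b. \<forall>x\<in>X. T (\<lambda>y. a * f y + b * g y) x = a * T f x + b * T g x) \<and>
     op_norm_C X T < 1"

section \<open>Radiative transfer\<close>

definition rotation_invariant ::
  "(real^'n) set \<Rightarrow> (real^'n \<Rightarrow> real^'n \<Rightarrow> real^'n \<Rightarrow> real) \<Rightarrow> bool" where
  "rotation_invariant A k \<longleftrightarrow>
     (\<exists>\<kappa>. \<forall>x\<in>A. \<forall>\<theta>\<in>usphere. \<forall>\<theta>'\<in>usphere. k x \<theta> \<theta>' = \<kappa> x (\<theta> \<bullet> \<theta>'))"

definition rho :: "(real^'n) set \<Rightarrow> (real^'n \<Rightarrow> real^'n \<Rightarrow> real^'n \<Rightarrow> real) \<Rightarrow> real" where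
  "rho X k = Linf_norm (restrict_space lborel X \<Otimes>\<^sub>M sphere_measure)
     (\<lambda>(x, \<theta>). \<integral>\<theta>'. k x \<theta> \<theta>' \<partial>sphere_measure)"

text \<open>\<open>\<theta> \<cdot> \<nabla>u\<close> is the derivative along characteristics, since a solution with merely continuous
  data need not be differentiable in other directions. The boundary values on the incoming set
  are limits along characteristics. As solutions are sought in \<open>L\<^sup>p(S, C(X))\<close>, the equation
  is imposed for almost every \<open>\<theta>\<close>.\<close>

definition forward_solution ::
  "(real^'n) set \<Rightarrow> (real^'n \<Rightarrow> real) \<Rightarrow> (real^'n \<Rightarrow> real^'n \<Rightarrow> real^'n \<Rightarrow> real) \<Rightarrow>
   (real^'n \<Rightarrow> real) \<Rightarrow> (real^'n \<Rightarrow> real^'n \<Rightarrow> real) \<Rightarrow> bool" where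
  "forward_solution X \<sigma> k f u \<longleftrightarrow> (AE \<theta> in sphere_measure.
     (\<forall>x\<in>X. \<exists>D. ((\<lambda>t. u (x + t *\<^sub>R \<theta>) \<theta>) has_real_derivative D) (at 0) \<and>
        D + \<sigma> x * u x \<theta> - (\<integral>\<theta>'. k x \<theta> \<theta>' * u x \<theta>' \<partial>sphere_measure) = f x) \<and>
     (\<forall>y. (y, \<theta>) \<in> Gamma_minus X \<longrightarrow> ((\<lambda>t. u (y + t *\<^sub>R \<theta>) \<theta>) \<longlongrightarrow> 0) (at_right 0)))"

definition adjoint_solution ::
  "(real^'n) set \<Rightarrow> (real^'n \<Rightarrow> real) \<Rightarrow> (real^'n \<Rightarrow> real^'n \<Rightarrow> real^'n \<Rightarrow> real) \<Rightarrow>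
   ((real^'n) \<times> (real^'n) \<Rightarrow> real) \<Rightarrow> (real^'n \<Rightarrow> real^'n \<Rightarrow> real) \<Rightarrow> bool" where
  "adjoint_solution X \<sigma> k f0 v \<longleftrightarrow>
     continuous_on (X \<times> usphere \<union> Gamma_plus X) (\<lambda>(x, \<theta>). v x \<theta>) \<and>
     (\<forall>x\<in>X. \<forall>\<theta>\<in>usphere. \<exists>D. ((\<lambda>t. v (x + t *\<^sub>R \<theta>) \<theta>) has_real_derivative D) (at 0) \<and>
        - D + \<sigma> x * v x \<theta> - (\<integral>\<theta>'. k x \<theta> \<theta>' * v x \<theta>' \<partial>sphere_measure) = 0) \<and>
     (\<forall>(y, \<theta>)\<in>Gamma_plus X. v y \<theta> = f0 (y, \<theta>))"

definition A_op ::
  "(real^'n \<Rightarrow> real) \<Rightarrow> (real^'n \<Rightarrow> real^'n \<Rightarrow> real^'n \<Rightarrow> real) \<Rightarrow>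
   (real^'n \<Rightarrow> real^'n \<Rightarrow> real) \<Rightarrow> real^'n \<Rightarrow> real^'n \<Rightarrow> real" where
  "A_op \<sigma> k u x \<theta> = - \<sigma> x * u x \<theta> + (\<integral>\<theta>'. k x \<theta> \<theta>' * u x \<theta>' \<partial>sphere_measure)"

definition K_op ::
  "(real^'n \<Rightarrow> real) \<Rightarrow> (real^'n \<Rightarrow> real^'n \<Rightarrow> real^'n \<Rightarrow> real) \<Rightarrow> (real^'n \<Rightarrow> real^'n \<Rightarrow> real) \<Rightarrow>
   (real^'n \<Rightarrow> real^'n \<Rightarrow> real) \<Rightarrow> real^'n \<Rightarrow> real" where
  "K_op \<sigma> k v u x = (\<integral>\<theta>. A_op \<sigma> k u x \<theta> * v x \<theta> \<partial>sphere_measure)"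

definition M_op ::
  "(real^'n \<Rightarrow> real^'n \<Rightarrow> real) \<Rightarrow> (real^'n \<Rightarrow> real) \<Rightarrow> real^'n \<Rightarrow> real" where
  "M_op v f x = f x / (\<integral>\<theta>. v x \<theta> \<partial>sphere_measure)"

definition internal_functional ::
  "(real^'n \<Rightarrow> real) \<Rightarrow> (real^'n \<Rightarrow> real^'n \<Rightarrow> real^'n \<Rightarrow> real) \<Rightarrow> (real^'n \<Rightarrow> real) \<Rightarrow>
   (real^'n \<Rightarrow> real^'n \<Rightarrow> real) \<Rightarrow> (real^'n \<Rightarrow> real^'n \<Rightarrow> real) \<Rightarrow> real^'n \<Rightarrow> real" where
  "internal_functional \<sigma> k S v u x =
     - (\<integral>\<theta>. \<sigma> x * u x \<theta> * v x \<theta> \<partial>sphere_measure)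
     + (\<integral>\<theta>. v x \<theta> * S x \<partial>sphere_measure)
     + (\<integral>\<theta>. (\<integral>\<theta>'. k x \<theta> \<theta>' * v x \<theta> * u x \<theta>' \<partial>sphere_measure) \<partial>sphere_measure)"

end

theory Submission
  imports Defs
begin

text \<open>
  Write \<open>T = M \<circ> K \<circ> Sol\<close> and \<open>d\<close> for the diameter of \<open>X\<close>. For the forward solution
  \<open>u = Sol S\<close> the internal functional is \<open>S(x) \<integral> v\<^sub>0 d\<theta> + K u(x)\<close>, so division by the
  integral of \<open>v\<^sub>0\<close> gives \<open>M H = S + T S\<close> (\<open>M_op_internal_functional\<close>). If \<open>T\<close> is a contraction,
  this equation is solved by the Neumann series (\<open>neumann_series_C\<close>). Everything thus rests on a
  bound for \<open>T\<close>, which in turn follows from the a priori estimate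
  \<open>|u| \<le> d / (1 - d \<rho>) * sup |f|\<close> for the solution \<open>u\<close> with source \<open>f\<close>
  (\<open>forward_solution_apriori\<close>).

  Along a characteristic that enters \<open>X\<close> through \<open>\<Gamma>\<^sub>-\<close> the transport equation is an ordinary
  differential equation with initial value \<open>0\<close>. Absorption only decreases \<open>|u|\<close>, and the length of the
  characteristic is at most \<open>d\<close>. Hence \<open>|u| \<le> d * sup |f + scattering|\<close>. If \<open>|u| \<le> C\<close>, the scattering
  term is at most \<open>\<rho> C\<close>, and \<open>d \<rho> < 1\<close> makes it possible to absorb it.

  Three points need care. A characteristic can graze the boundary, where no boundary value is
  prescribed; \<open>transversal_exit_dense\<close> shows by a touching argument that the characteristics which
  enter transversally are dense, and \<open>characteristic_bound\<close> concludes by continuity. Absorbing the scattering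
  term presupposes a finite bound, while a solution is only known to lie in \<open>L\<^sup>p\<close>;
  \<open>ess_bounded_of_LpC\<close> supplies one. Finally \<open>\<rho>\<close> is an essential
  supremum over \<open>(x, \<theta>)\<close>, whereas the estimate needs, for almost every \<open>\<theta>\<close>, a bound at every \<open>x\<close>;
  this is \<open>AE_total_scattering_le_rho\<close>.

  Linearity of \<open>T\<close> is not built into the solution map. It follows from the a priori estimate, applied to
  the difference of \<open>Sol (a f + b g)\<close> and \<open>a Sol f + b Sol g\<close>, which solves the equation
  without source.
\<close>

section \<open>Contractions on bounded continuous functions\<close>

lemma abs_le_sup_norm:
  assumes "f \<in> Cb X" "x \<in> X"
  shows "\<bar>f x\<bar> \<le> sup_norm X f"
proof -
  have "bdd_above ((\<lambda>z. \<bar>f z\<bar>) ` X)"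
    using assms(1) by (auto simp: Cb_def bounded_real bdd_above_def)
  then show ?thesis
    unfolding sup_norm_def using assms(2) by (rule cSUP_upper2) simp
qed

lemma sup_norm_le:
  assumes "X \<noteq> {}" "\<And>x. x \<in> X \<Longrightarrow> \<bar>f x\<bar> \<le> C"
  shows "sup_norm X f \<le> C"
  unfolding sup_norm_def using assms by (rule cSUP_least)

lemma CbI:
  assumes "continuous_on X f" "\<And>x. x \<in> X \<Longrightarrow> \<bar>f x\<bar> \<le> C"
  shows "f \<in> Cb X"
  using assms by (auto simp: Cb_def bounded_real)

lemma Cb_lincomb:
  assumes "f \<in> Cb X" "g \<in> Cb X"
  shows "(\<lambda>y. a * f y + b * g y) \<in> Cb X"
proof (rule CbI)
  show "continuous_on X (\<lambda>y. a * f y + b * g y)"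
    using assms by (auto simp: Cb_def intro!: continuous_intros)
  fix x assume "x \<in> X"
  then have "\<bar>f x\<bar> \<le> sup_norm X f" "\<bar>g x\<bar> \<le> sup_norm X g"
    using assms by (auto intro: abs_le_sup_norm)
  then show "\<bar>a * f x + b * g x\<bar> \<le> \<bar>a\<bar> * sup_norm X f + \<bar>b\<bar> * sup_norm X g"
    by (intro order_trans[OF abs_triangle_ineq] add_mono) (auto simp: abs_mult intro: mult_left_mono)
qed

text \<open>The operator norm only tests functions of norm at most one. For other \<open>f\<close> linearity allows rescaling. Rescaling by \<open>C + e\<close> instead of
  by \<open>C\<close> also covers functions that vanish on \<open>X\<close> but not outside it, and hence shows that
  \<open>T f\<close> on \<open>X\<close> is determined by the values of \<open>f\<close> there.\<close>

lemma contraction_C_factor: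
  assumes T: "contraction_C X T"
  obtains q where "0 \<le> q" "q < 1"
    "\<And>f C x. f \<in> Cb X \<Longrightarrow> (\<And>x. x \<in> X \<Longrightarrow> \<bar>f x\<bar> \<le> C) \<Longrightarrow> x \<in> X \<Longrightarrow> \<bar>T f x\<bar> \<le> q * C"
proof -
  have Cb: "T f \<in> Cb X" if "f \<in> Cb X" for f
    using T that by (simp add: contraction_C_def)
  have lin: "T (\<lambda>y. a * f y + b * g y) x = a * T f x + b * T g x"
    if "f \<in> Cb X" "g \<in> Cb X" "x \<in> X" for f g a b x
    using T that by (simp add: contraction_C_def)
  have "op_norm_C X T < 1" using T by (simp add: contraction_C_def)
  then obtain q0 where q0: "op_norm_C X T < ereal q0" "ereal q0 < 1"
    using ereal_dense2 by blast
  define q where "q = max 0 q0"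
  have q: "0 \<le> q" "q < 1" using q0 by (auto simp: q_def)
  have unit: "\<bar>T f x\<bar> \<le> q" if f: "f \<in> Cb X" "\<And>x. x \<in> X \<Longrightarrow> \<bar>f x\<bar> \<le> 1" and x: "x \<in> X" for f x
  proof -
    have "sup_norm X f \<le> 1" using f(2) x by (intro sup_norm_le) auto
    then have "ereal (sup_norm X (T f)) \<le> op_norm_C X T"
      unfolding op_norm_C_def using f(1) by (intro SUP_upper) simp
    then have "ereal (sup_norm X (T f)) < ereal q0" using q0(1) by (rule order_le_less_trans)
    then have "sup_norm X (T f) \<le> q" by (simp add: q_def)
    with abs_le_sup_norm[OF Cb[OF f(1)] x] show ?thesis by simp
  qed
  have "\<bar>T f x\<bar> \<le> q * C"
    if f: "f \<in> Cb X" and C: "\<And>x. x \<in> X \<Longrightarrow> \<bar>f x\<bar> \<le> C" and x: "x \<in> X" for f C x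
  proof (rule field_le_epsilon)
    fix e :: real assume e: "e > 0"
    define N where "N = C + e"
    have "C \<ge> 0" using C[OF x] by simp
    then have N: "N > 0" using e by (simp add: N_def)
    have "\<bar>T (\<lambda>y. (1 / N) * f y + 0 * f y) x\<bar> \<le> q"
    proof (rule unit[OF Cb_lincomb[OF f f] _ x])
      fix y assume "y \<in> X"
      then have "\<bar>f y\<bar> \<le> N" using C e by (force simp: N_def)
      then show "\<bar>(1 / N) * f y + 0 * f y\<bar> \<le> 1" using N by (simp add: field_simps)
    qed
    then have "\<bar>T f x\<bar> / N \<le> q"
      using lin[OF f f x, of "1 / N" 0] N by simp
    then have "\<bar>T f x\<bar> \<le> q * N" using N by (simp add: field_simps)
    also have "\<dots> \<le> q * C + e"
      using q e mult_right_mono[of q 1 e] by (simp add: N_def algebra_simps)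
    finally show "\<bar>T f x\<bar> \<le> q * C + e" .
  qed
  with q show ?thesis using that by blast
qed

text \<open>With \<open>R = -T\<close> the hypothesis reads \<open>g = S - R S\<close> on \<open>X\<close>, so the partial sums telescope to
  \<open>S - R\<^sup>N S\<close>. Since \<open>g\<close> and \<open>S - R S\<close> may differ outside \<open>X\<close>, each step of the telescoping
  uses that \<open>T\<close> maps functions that agree on \<open>X\<close> to functions that agree on \<open>X\<close>.\<close>

lemma neumann_series_C:
  assumes T: "contraction_C X T" and S: "S \<in> Cb X"
    and g: "\<And>x. x \<in> X \<Longrightarrow> g x = S x + T S x"
  shows "uniform_limit X (\<lambda>N x. \<Sum>j<N. ((\<lambda>f y. - T f y) ^^ j) g x) S sequentially"
proof -
  define R where "R = (\<lambda>f y. - T f y)"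
  obtain q where q: "0 \<le> q" "q < 1"
    "\<And>f C x. f \<in> Cb X \<Longrightarrow> (\<And>x. x \<in> X \<Longrightarrow> \<bar>f x\<bar> \<le> C) \<Longrightarrow> x \<in> X \<Longrightarrow> \<bar>T f x\<bar> \<le> q * C"
    using contraction_C_factor[OF T] by metis
  have lin: "T (\<lambda>y. a * f y + b * g y) x = a * T f x + b * T g x"
    if "f \<in> Cb X" "g \<in> Cb X" "x \<in> X" for f g a b x
    using T that by (simp add: contraction_C_def)
  have RCb: "R f \<in> Cb X" if "f \<in> Cb X" for f
  proof -
    have "T f \<in> Cb X" using T that by (simp add: contraction_C_def)
    from Cb_lincomb[OF this this, of "-1" 0] show ?thesis by (simp add: R_def)
  qed
  have RjCb: "(R ^^ j) f \<in> Cb X" if "f \<in> Cb X" for f j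
    by (induction j) (auto simp: that RCb)
  have cong: "T f x = T h x" if "f \<in> Cb X" "h \<in> Cb X" "\<And>x. x \<in> X \<Longrightarrow> f x = h x" "x \<in> X" for f h x
  proof -
    have "\<bar>T (\<lambda>y. 1 * f y + (-1) * h y) x\<bar> \<le> q * 0"
      using that by (intro q(3) Cb_lincomb) auto
    then show ?thesis using lin[OF that(1,2,4), of 1 "-1"] by simp
  qed
  have gCb: "g \<in> Cb X"
  proof -
    have h: "(\<lambda>y. 1 * S y + (-1) * R S y) \<in> Cb X"
      by (intro Cb_lincomb S RCb)
    have eq: "g x = 1 * S x + (-1) * R S x" if "x \<in> X" for x
      using g[OF that] by (simp add: R_def)
    have "continuous_on X (\<lambda>y. 1 * S y + (-1) * R S y)"
      using h unfolding Cb_def by blast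
    then have "continuous_on X g"
      by (rule continuous_on_eq) (simp only: eq)
    moreover have "g ` X = (\<lambda>y. 1 * S y + (-1) * R S y) ` X"
      using eq by (rule image_cong[OF refl])
    ultimately show ?thesis using h by (simp only: Cb_def mem_Collect_eq)
  qed
  have step: "(R ^^ j) g x = (R ^^ j) S x - (R ^^ Suc j) S x" if "x \<in> X" for j x
    using that
  proof (induction j arbitrary: x)
    case 0
    then show ?case using g by (simp add: R_def)
  next
    case (Suc j)
    let ?h = "\<lambda>y. 1 * (R ^^ j) S y + (-1) * (R ^^ Suc j) S y"
    have "T ((R ^^ j) g) x = T ?h x"
    proof (rule cong)
      show "(R ^^ j) g \<in> Cb X" by (rule RjCb[OF gCb])
      show "?h \<in> Cb X" by (intro Cb_lincomb RjCb S)
      show "(R ^^ j) g y = ?h y" if "y \<in> X" for y using Suc.IH[OF that] by simp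
      show "x \<in> X" by fact
    qed
    also have "\<dots> = 1 * T ((R ^^ j) S) x + (-1) * T ((R ^^ Suc j) S) x"
      by (intro lin RjCb S Suc.prems)
    finally show ?case by (simp add: R_def)
  qed
  have partial: "(\<Sum>j<N. (R ^^ j) g x) = S x - (R ^^ N) S x" if "x \<in> X" for N x
    using that by (induction N) (auto simp: step)
  define M where "M = sup_norm X S"
  have decay: "\<bar>(R ^^ j) S x\<bar> \<le> q ^ j * M" if "x \<in> X" for j x
    using that
  proof (induction j arbitrary: x)
    case 0
    then show ?case using abs_le_sup_norm[OF S] by (simp add: M_def)
  next
    case (Suc j)
    have "\<bar>T ((R ^^ j) S) x\<bar> \<le> q * (q ^ j * M)"
      using Suc.IH by (intro q(3) RjCb S Suc.prems)
    then show ?case by (simp add: R_def mult.assoc)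
  qed
  have "uniform_limit X (\<lambda>N x. \<Sum>j<N. (R ^^ j) g x) S sequentially"
  proof (rule uniform_limitI)
    fix e :: real assume "e > 0"
    have "(\<lambda>N. q ^ N * M) \<longlonglongrightarrow> 0 * M"
      using q by (intro tendsto_mult LIMSEQ_realpow_zero tendsto_const)
    then have "(\<lambda>N. q ^ N * M) \<longlonglongrightarrow> 0" by simp
    from order_tendstoD(2)[OF this \<open>e > 0\<close>]
    show "\<forall>\<^sub>F N in sequentially. \<forall>x\<in>X. dist (\<Sum>j<N. (R ^^ j) g x) (S x) < e"
    proof eventually_elim
      case (elim N)
      show ?case
      proof
        fix x assume "x \<in> X"
        then have "dist (\<Sum>j<N. (R ^^ j) g x) (S x) = \<bar>(R ^^ N) S x\<bar>"
          by (simp add: partial dist_real_def)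
        also have "\<dots> \<le> q ^ N * M" using \<open>x \<in> X\<close> by (rule decay)
        finally show "dist (\<Sum>j<N. (R ^^ j) g x) (S x) < e" using elim by simp
      qed
    qed
  qed
  then show ?thesis by (simp add: R_def)
qed

section \<open>Geometry of the boundary\<close>

lemma GDERIV_line:
  fixes \<phi> :: "'a::real_inner \<Rightarrow> real"
  assumes "GDERIV \<phi> y :> g"
  shows "((\<lambda>t. \<phi> (y + t *\<^sub>R h)) has_real_derivative g \<bullet> h) (at 0)"
proof -
  have 1: "((\<lambda>t::real. y + t *\<^sub>R h) has_derivative (\<lambda>t. t *\<^sub>R h)) (at 0)"
    by (auto intro!: derivative_eq_intros)
  have 2: "(\<phi> has_derivative (\<lambda>h. h \<bullet> g)) (at (y + 0 *\<^sub>R h))"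
    using assms by (simp add: gderiv_def)
  have "((\<lambda>t. \<phi> (y + t *\<^sub>R h)) has_derivative (\<lambda>t. (t *\<^sub>R h) \<bullet> g)) (at 0)"
    using has_derivative_compose[OF 1 2] by simp
  then show ?thesis
    by (simp add: has_field_derivative_def inner_commute mult_commute_abs)
qed

lemma eventually_line_in_open:
  fixes y h :: "'a::real_normed_vector"
  assumes "open U" "y \<in> U"
  shows "\<forall>\<^sub>F t in at_right 0. y + t *\<^sub>R h \<in> U"
proof -
  have "((\<lambda>t. y + t *\<^sub>R h) \<longlongrightarrow> y + 0 *\<^sub>R h) (at_right 0)"
    by (intro tendsto_intros)
  then show ?thesis
    using assms topological_tendstoD by fastforce
qed

lemma local_defining_functionD:
  assumes "local_defining_function X y U \<phi>"
  shows "open U" "y \<in> U" "z \<in> U \<Longrightarrow> z \<in> X \<longleftrightarrow> \<phi> z < 0"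
    "\<exists>g. GDERIV \<phi> y :> g \<and> g \<noteq> 0"
proof -
  note d = assms[unfolded local_defining_function_def]
  show "open U" using d by (rule conjunct1)
  show 2: "y \<in> U" using d[THEN conjunct2] by (rule conjunct1)
  have 3: "\<forall>z\<in>U. \<exists>g. GDERIV \<phi> z :> g \<and> g \<noteq> 0"
    using d[THEN conjunct2, THEN conjunct2, THEN conjunct2] by (rule conjunct1)
  have 4: "X \<inter> U = {z\<in>U. \<phi> z < 0}"
    using d[THEN conjunct2, THEN conjunct2, THEN conjunct2] by (rule conjunct2)
  show "\<exists>g. GDERIV \<phi> y :> g \<and> g \<noteq> 0" using 3 2 by (rule bspec)
  show "z \<in> X \<longleftrightarrow> \<phi> z < 0" if "z \<in> U"
  proof -
    have "z \<in> X \<inter> U \<longleftrightarrow> z \<in> {z\<in>U. \<phi> z < 0}" by (simp only: 4)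
    then show ?thesis using that by simp
  qed
qed

lemma defining_function_zero:
  assumes "open X" "y \<in> frontier X" "local_defining_function X y U \<phi>"
  shows "\<phi> y = 0"
proof -
  note U = local_defining_functionD[OF assms(3)]
  have "y \<notin> X"
    using assms(1,2) by (simp add: frontier_def interior_open)
  then have ge: "\<phi> y \<ge> 0"
    using U by auto
  obtain g where "GDERIV \<phi> y :> g"
    using U(4) by blast
  then have cont: "isCont \<phi> y"
    by (auto simp: gderiv_def intro: has_derivative_continuous)
  have "\<not> \<phi> y > 0"
  proof
    assume "\<phi> y > 0"
    then have "\<forall>\<^sub>F z in nhds y. \<phi> z > 0"
      using cont by (simp add: continuous_within order_tendstoD(1) tendsto_at_iff_tendsto_nhds)
    moreover have "\<forall>\<^sub>F z in nhds y. z \<in> U"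
      using U by (simp add: eventually_nhds_in_open)
    ultimately have "\<forall>\<^sub>F z in nhds y. z \<notin> X"
      by eventually_elim (use U(3) in fastforce)
    then obtain V where "open V" "y \<in> V" "\<forall>z\<in>V. z \<notin> X"
      by (auto simp: eventually_nhds)
    moreover have "y \<in> closure X"
      using assms(2) by (simp add: frontier_def)
    ultimately show False
      using open_Int_closure_eq_empty[of V X] by auto
  qed
  with ge show ?thesis by simp
qed

lemma descent_direction_enters:
  assumes "open X" "y \<in> frontier X" "local_defining_function X y U \<phi>"
    and "GDERIV \<phi> y :> g" "g \<bullet> h < 0"
  shows "\<forall>\<^sub>F t in at_right 0. y + t *\<^sub>R h \<in> X"
proof -
  note U = local_defining_functionD[OF assms(3)]
  obtain d where "d > 0" "\<And>t. 0 < t \<Longrightarrow> t < d \<Longrightarrow> \<phi> (y + t *\<^sub>R h) < \<phi> y"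
    using DERIV_neg_dec_right[OF GDERIV_line[OF assms(4)] assms(5)] by auto
  then have "\<forall>\<^sub>F t in at_right 0. \<phi> (y + t *\<^sub>R h) < 0"
    using defining_function_zero[OF assms(1-3)]
    by (auto simp: eventually_at_right_field)
  with eventually_line_in_open[OF U(1,2)] show ?thesis
    by eventually_elim (use U(3) in blast)
qed

lemma entering_direction_descends:
  assumes "open X" "y \<in> frontier X" "local_defining_function X y U \<phi>"
    and "GDERIV \<phi> y :> g" "\<forall>\<^sub>F t in at_right 0. y + t *\<^sub>R h \<in> X"
  shows "g \<bullet> h \<le> 0"
proof (rule ccontr)
  assume "\<not> g \<bullet> h \<le> 0"
  then have pos: "0 < g \<bullet> h" by simp
  note U = local_defining_functionD[OF assms(3)]
  obtain d where "d > 0" "\<And>t. 0 < t \<Longrightarrow> t < d \<Longrightarrow> \<phi> y < \<phi> (y + t *\<^sub>R h)"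
    using DERIV_pos_inc_right[OF GDERIV_line[OF assms(4)] pos] by auto
  then have "\<forall>\<^sub>F t in at_right 0. \<phi> (y + t *\<^sub>R h) > 0"
    using defining_function_zero[OF assms(1-3)]
    by (auto simp: eventually_at_right_field)
  with eventually_line_in_open[OF U(1,2), of h] assms(5) have "\<forall>\<^sub>F t::real in at_right 0. False"
    by eventually_elim (use U(3) in force)
  then show False by simp
qed

text \<open>Uniqueness of the normal: a direction along which one defining function decreases enters \<open>X\<close>,
  so no other defining function increases along it. If the normalised gradients \<open>a\<close> and \<open>b\<close>
  differed, the direction \<open>b - a\<close> would decrease the first function and increase the second.\<close>

lemma outer_normal_eq:
  assumes X: "open X" "y \<in> frontier X" and ldf: "local_defining_function X y U \<phi>"
    and g: "GDERIV \<phi> y :> g"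
  shows "outer_normal X y = sgn g"
  unfolding outer_normal_def
proof (rule the_equality)
  show "\<exists>U \<phi> g'. local_defining_function X y U \<phi> \<and> GDERIV \<phi> y :> g' \<and> sgn g = sgn g'"
    using ldf g by blast
next
  fix \<nu> assume "\<exists>U \<phi> g. local_defining_function X y U \<phi> \<and> GDERIV \<phi> y :> g \<and> \<nu> = sgn g"
  then obtain U' \<phi>' g' where ldf': "local_defining_function X y U' \<phi>'"
      and g': "GDERIV \<phi>' y :> g'" and \<nu>: "\<nu> = sgn g'"
    by blast
  have nz: "a \<noteq> 0" if V: "local_defining_function X y V \<psi>" "GDERIV \<psi> y :> a" for V \<psi> a
  proof -
    obtain b where b: "GDERIV \<psi> y :> b" "b \<noteq> 0"
      using local_defining_functionD(4)[OF V(1)] by blast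
    then have "(\<lambda>h. h \<bullet> a) = (\<lambda>h. h \<bullet> b)"
      using V(2) by (auto simp: gderiv_def intro: has_derivative_unique)
    then have "a = b" by (metis vector_eq_ldot)
    with b show ?thesis by simp
  qed
  have n: "norm (sgn g) = 1" "norm (sgn g') = 1"
    using nz[OF ldf g] nz[OF ldf' g'] by (simp_all add: norm_sgn)
  show "\<nu> = sgn g"
  proof (rule ccontr)
    assume "\<nu> \<noteq> sgn g"
    then have ne: "sgn g' \<noteq> sgn g" using \<nu> by simp
    define h where "h = sgn g' - sgn g"
    have sq: "sgn g \<bullet> sgn g = 1" "sgn g' \<bullet> sgn g' = 1"
      using n by (simp_all add: dot_square_norm)
    have "0 < h \<bullet> h" using ne by (simp add: h_def)
    then have lt: "sgn g \<bullet> sgn g' < 1"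
      using sq by (simp add: h_def inner_diff inner_commute)
    have "sgn g \<bullet> h < 0" "sgn g' \<bullet> h > 0"
      using lt sq by (simp_all add: h_def inner_diff inner_commute)
    moreover have "g = norm g *\<^sub>R sgn g" "g' = norm g' *\<^sub>R sgn g'"
      using nz[OF ldf g] nz[OF ldf' g'] by (simp_all add: sgn_div_norm)
    ultimately have "g \<bullet> h < 0" "g' \<bullet> h > 0"
      using nz[OF ldf g] nz[OF ldf' g']
      by (metis inner_scaleR_left mult_pos_neg zero_less_norm_iff,
          metis inner_scaleR_left mult_pos_pos zero_less_norm_iff \<open>g' \<noteq> 0\<close>)
    from descent_direction_enters[OF X ldf g this(1)]
    have "g' \<bullet> h \<le> 0"
      by (rule entering_direction_descends[OF X ldf' g'])
    with \<open>g' \<bullet> h > 0\<close> show False by simp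
  qed
qed

text \<open>A backward characteristic may leave \<open>X\<close> tangentially, at a point outside \<open>\<Gamma>\<^sub>-\<close> where the
  boundary condition says nothing. Near every \<open>x0\<close> there is nevertheless a point whose
  characteristic leaves transversally. In place of Sard's theorem, a paraboloid with axis \<open>\<theta>\<close>
  is moved in the direction \<open>-\<theta>\<close> until it first touches the frontier inside a thin
  cylinder around the characteristic of \<open>x0\<close>. At the point of contact \<open>y1\<close>, all points just
  above the paraboloid belong to \<open>X\<close>. As the paraboloid is nowhere vertical, this rules out that
  \<open>\<theta>\<close> is tangent to the boundary at \<open>y1\<close>.\<close>

lemma transversal_exit_dense:
  fixes X :: "(real^'n) set"
  assumes X: "open X" "bounded X" "smooth_boundary X" and \<theta>: "norm \<theta> = 1"
    and x0: "x0 \<in> X" and e: "e > 0"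
  obtains x s where "x \<in> X" "dist x x0 < e" "0 < s" "s \<le> diameter X"
    "\<And>t. 0 \<le> t \<Longrightarrow> t < s \<Longrightarrow> x - t *\<^sub>R \<theta> \<in> X" "(x - s *\<^sub>R \<theta>, \<theta>) \<in> Gamma_minus X"
proof -
  obtain r0 where r0: "r0 > 0" "cball x0 r0 \<subseteq> X"
    using X(1) x0 open_contains_cball by blast
  define r where "r = min r0 (e / 2)"
  have r: "r > 0" "r < e" "cball x0 r \<subseteq> X"
    using r0 e by (auto simp: r_def)
  define D where "D = diameter X + 1"
  have D: "D > diameter X" "D > 0"
    using diameter_ge_0[OF X(2)] by (auto simp: D_def)
  \<comment> \<open>This opening makes the paraboloid so steep that it touches the frontier before it reaches the side of the cylinder.\<close>
  define N where "N = (D + 1) / r\<^sup>2"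
  have N: "N > 0" "N * r\<^sup>2 > D"
    using r(1) D by (auto simp: N_def)
  \<comment> \<open>The orthogonal projection along \<open>\<theta>\<close>.\<close>
  define P where "P z = z - (z \<bullet> \<theta>) *\<^sub>R \<theta>" for z
  have \<theta>\<theta>: "\<theta> \<bullet> \<theta> = 1" using \<theta> by (simp add: dot_square_norm)
  have P\<theta>: "P z \<bullet> \<theta> = 0" for z
    by (simp add: P_def inner_diff_left \<theta>\<theta>)
  have Padd: "P (a + b) = P a + P b" for a b
    by (simp add: P_def algebra_simps inner_add_left)
  have Pscale: "P (t *\<^sub>R a) = t *\<^sub>R P a" for t a
    by (simp add: P_def algebra_simps)
  have P0: "P \<theta> = 0" by (simp add: P_def \<theta>\<theta>)
  have Pid: "P a = a" if "a \<bullet> \<theta> = 0" for a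
    using that by (simp add: P_def)
  \<comment> \<open>The level sets of \<open>q\<close> are the positions of the moving paraboloid, and \<open>C\<close> is the part of the frontier in the cylinder below \<open>x0\<close>.\<close>
  define q where "q y = N * (norm (P (y - x0)))\<^sup>2 - (y - x0) \<bullet> \<theta>" for y
  define C where "C = frontier X \<inter> {y. norm (P (y - x0)) \<le> r \<and> (y - x0) \<bullet> \<theta> \<le> 0}"
  have "closed {y. norm (P (y - x0)) \<le> r \<and> (y - x0) \<bullet> \<theta> \<le> 0}"
    unfolding P_def by (intro closed_Collect_conj closed_Collect_le continuous_intros)
  then have C: "compact C"
    unfolding C_def using X(2) by (intro compact_Int_closed compact_frontier_bounded)
  have frontier_notin: "y \<notin> X" if "y \<in> frontier X" for y
    using that X(1) by (simp add: frontier_def interior_open)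
  have segment_frontier: "\<exists>t\<in>{0..a}. z + t *\<^sub>R w \<in> frontier X"
    if "0 \<le> a" "(z \<in> X) \<noteq> (z + a *\<^sub>R w \<in> X)" for z w a
  proof -
    have "closed_segment z (z + a *\<^sub>R w) \<inter> frontier X \<noteq> {}"
      using that by (intro connected_Int_frontier) auto
    then obtain u where u: "0 \<le> u" "u \<le> 1" "(1 - u) *\<^sub>R z + u *\<^sub>R (z + a *\<^sub>R w) \<in> frontier X"
      by (auto simp: closed_segment_def)
    have "(1 - u) *\<^sub>R z + u *\<^sub>R (z + a *\<^sub>R w) = z + (u * a) *\<^sub>R w"
      by (simp add: algebra_simps)
    moreover have "u * a \<in> {0..a}"
      using u that(1) by (auto simp: mult_left_le_one_le)
    ultimately show ?thesis using u(3) by metis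
  qed
  obtain t0 where t0: "0 \<le> t0" "t0 \<le> D" "x0 + t0 *\<^sub>R (- \<theta>) \<in> frontier X"
  proof -
    have "x0 + D *\<^sub>R (- \<theta>) \<notin> X"
    proof
      assume "x0 + D *\<^sub>R (- \<theta>) \<in> X"
      then have "dist x0 (x0 + D *\<^sub>R (- \<theta>)) \<le> diameter X"
        using X(2) x0 by (intro diameter_bounded_bound)
      then show False using D \<theta> by (simp add: dist_norm)
    qed
    then show ?thesis
      using segment_frontier[of D x0 "- \<theta>"] x0 D that by auto
  qed
  have t0C: "x0 + t0 *\<^sub>R (- \<theta>) \<in> C"
    using t0 r(1) Pscale[of "- t0" \<theta>] by (simp add: C_def P0 \<theta>\<theta>)
  have "continuous_on C q"
    unfolding q_def P_def by (intro continuous_intros)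
  then obtain y1 where y1: "y1 \<in> C" "\<And>y. y \<in> C \<Longrightarrow> q y1 \<le> q y"
    using continuous_attains_inf[OF C] t0C by blast
  have "q y1 \<le> q (x0 + t0 *\<^sub>R (- \<theta>))"
    by (rule y1(2)[OF t0C])
  also have "\<dots> \<le> D"
    using t0 Pscale[of "- t0" \<theta>] by (simp add: q_def P0 \<theta>\<theta>)
  finally have qD: "q y1 \<le> D" .
  define p where "p = P (y1 - x0)"
  define s where "s = - ((y1 - x0) \<bullet> \<theta>)"
  define x1 where "x1 = x0 + p"
  have y1_eq: "y1 = x1 - s *\<^sub>R \<theta>"
    by (simp add: x1_def p_def s_def P_def)
  have p\<theta>: "p \<bullet> \<theta> = 0" by (simp add: p_def P\<theta>)
  have y1f: "y1 \<in> frontier X" and s0: "s \<ge> 0"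
    using y1(1) by (auto simp: C_def s_def)
  have qy1: "q y1 = N * (norm p)\<^sup>2 + s"
    by (simp add: q_def p_def s_def)
  have "N * (norm p)\<^sup>2 < N * r\<^sup>2"
    using qD qy1 s0 N by linarith
  then have "(norm p)\<^sup>2 < r\<^sup>2"
    using N(1) by simp
  then have pr: "norm p < r"
    using r(1) by (simp add: power2_less_imp_less)
  have x1X: "x1 \<in> X"
    using r(3) pr by (auto simp: x1_def dist_norm)
  have "s \<noteq> 0"
    using x1X y1f frontier_notin y1_eq by auto
  with s0 have s: "s > 0" by simp
  \<comment> \<open>Going up from \<open>w\<close> decreases \<open>q\<close> below its minimum on \<open>C\<close>, so the frontier is not met before the ball around \<open>x0\<close>.\<close>
  have below: "w \<in> X"
    if w: "norm (P (w - x0)) \<le> r" "(w - x0) \<bullet> \<theta> \<le> 0" "q w < q y1" for w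
  proof (rule ccontr)
    assume "w \<notin> X"
    define a where "a = - ((w - x0) \<bullet> \<theta>)"
    have "w + a *\<^sub>R \<theta> = x0 + P (w - x0)"
      by (simp add: a_def P_def)
    then have "w + a *\<^sub>R \<theta> \<in> X"
      using r(3) w(1) by (auto simp: dist_norm)
    then obtain t where t: "0 \<le> t" "t \<le> a" "w + t *\<^sub>R \<theta> \<in> frontier X"
      using segment_frontier[of a w \<theta>] \<open>w \<notin> X\<close> w(2) by (auto simp: a_def)
    have "w + t *\<^sub>R \<theta> - x0 = (w - x0) + t *\<^sub>R \<theta>" by simp
    then have Pw: "P (w + t *\<^sub>R \<theta> - x0) = P (w - x0)"
      and ip: "(w + t *\<^sub>R \<theta> - x0) \<bullet> \<theta> = (w - x0) \<bullet> \<theta> + t"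
      by (simp_all only: Padd Pscale P0 inner_add_left inner_scaleR_left \<theta>\<theta>) simp_all
    have "w + t *\<^sub>R \<theta> \<in> C"
      using t w(1) Pw ip by (simp add: C_def a_def)
    then have "q y1 \<le> q (w + t *\<^sub>R \<theta>)" by (rule y1(2))
    also have "\<dots> = q w - t" using Pw ip by (simp add: q_def)
    finally show False using w(3) t(1) by simp
  qed
  have inside: "x1 - t *\<^sub>R \<theta> \<in> X" if t: "0 \<le> t" "t < s" for t
  proof (rule below)
    have "x1 - t *\<^sub>R \<theta> - x0 = p + (- t) *\<^sub>R \<theta>" by (simp add: x1_def)
    then have "P (x1 - t *\<^sub>R \<theta> - x0) = p" "(x1 - t *\<^sub>R \<theta> - x0) \<bullet> \<theta> = - t"
      by (simp_all only: Padd Pscale P0 inner_add_left inner_scaleR_left \<theta>\<theta> p\<theta> Pid) simp_all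
    then show "norm (P (x1 - t *\<^sub>R \<theta> - x0)) \<le> r" "(x1 - t *\<^sub>R \<theta> - x0) \<bullet> \<theta> \<le> 0"
        "q (x1 - t *\<^sub>R \<theta>) < q y1"
      using t pr qy1 by (simp_all add: q_def)
  qed
  obtain U \<phi> where ldf: "local_defining_function X y1 U \<phi>"
    using X(3) y1f by (auto simp: smooth_boundary_def)
  then obtain g where g: "GDERIV \<phi> y1 :> g" "g \<noteq> 0"
    using local_defining_functionD(4) by blast
  have "\<forall>\<^sub>F t in at_right 0. y1 + t *\<^sub>R \<theta> \<in> X"
  proof -
    have "y1 + t *\<^sub>R \<theta> \<in> X" if "0 < t" "t < s" for t
      using inside[of "s - t"] that by (simp add: y1_eq algebra_simps)
    then show ?thesis using s by (auto simp: eventually_at_right_field)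
  qed
  then have le: "g \<bullet> \<theta> \<le> 0"
    by (rule entering_direction_descends[OF X(1) y1f ldf g(1)])
  have "g \<bullet> \<theta> \<noteq> 0"
  proof
    assume g\<theta>: "g \<bullet> \<theta> = 0"
    \<comment> \<open>If \<open>\<theta>\<close> were tangent, tilting it slightly towards \<open>g\<close> would give a direction that enters \<open>X\<close> above the paraboloid although \<open>\<phi>\<close> increases along it. This \<open>\<epsilon>\<close> keeps the tilt below the slope of the paraboloid.\<close>
    define \<epsilon> where "\<epsilon> = 1 / (4 * N * \<bar>p \<bullet> g\<bar> + 1)"
    have \<epsilon>: "\<epsilon> > 0" using N(1) by (simp add: \<epsilon>_def add_nonneg_pos)
    have "2 * N * (p \<bullet> g) * \<epsilon> \<le> 2 * N * \<bar>p \<bullet> g\<bar> * \<epsilon>"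
      using N(1) \<epsilon> by (intro mult_right_mono mult_left_mono) auto
    also have "\<dots> \<le> 1/2"
      using N(1) unfolding \<epsilon>_def by (auto simp: divide_simps add_nonneg_pos)
    finally have \<epsilon>2: "2 * N * (p \<bullet> g) * \<epsilon> \<le> 1/2" .
    define h where "h = \<theta> + \<epsilon> *\<^sub>R g"
    have ev1: "\<forall>\<^sub>F \<delta> in at_right 0. norm (p + (\<delta> * \<epsilon>) *\<^sub>R g) < r"
    proof -
      have "((\<lambda>\<delta>. norm (p + (\<delta> * \<epsilon>) *\<^sub>R g)) \<longlongrightarrow> norm (p + (0 * \<epsilon>) *\<^sub>R g)) (at_right 0)"
        by (intro tendsto_intros)
      then show ?thesis using pr by (auto dest: order_tendstoD(2))
    qed
    have ev2: "\<forall>\<^sub>F \<delta> in at_right 0. \<delta> * (N * \<epsilon>\<^sup>2 * (norm g)\<^sup>2) < 1/2"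
    proof -
      have "((\<lambda>\<delta>. \<delta> * (N * \<epsilon>\<^sup>2 * (norm g)\<^sup>2)) \<longlongrightarrow> 0 * (N * \<epsilon>\<^sup>2 * (norm g)\<^sup>2)) (at_right 0)"
        by (intro tendsto_intros)
      from order_tendstoD(2)[OF this, of "1/2"] show ?thesis by simp
    qed
    have ev3: "\<forall>\<^sub>F \<delta> in at_right 0. 0 < \<delta> \<and> \<delta> < s"
      using s by (auto simp: eventually_at_right_field)
    from ev1 ev2 ev3 have "\<forall>\<^sub>F \<delta> in at_right 0. y1 + \<delta> *\<^sub>R h \<in> X"
    proof eventually_elim
      case (elim \<delta>)
      have eq: "y1 + \<delta> *\<^sub>R h - x0 = p + (\<delta> * \<epsilon>) *\<^sub>R g + (\<delta> - s) *\<^sub>R \<theta>"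
        by (simp add: y1_eq x1_def h_def algebra_simps)
      then have Ph: "P (y1 + \<delta> *\<^sub>R h - x0) = p + (\<delta> * \<epsilon>) *\<^sub>R g"
        and ip: "(y1 + \<delta> *\<^sub>R h - x0) \<bullet> \<theta> = \<delta> - s"
        by (simp_all only: Padd Pscale P0 inner_add_left inner_scaleR_left \<theta>\<theta> p\<theta> Pid g\<theta>) simp_all
      have "(norm (p + (\<delta> * \<epsilon>) *\<^sub>R g))\<^sup>2
          = (norm p)\<^sup>2 + 2 * (\<delta> * \<epsilon>) * (p \<bullet> g) + (\<delta> * \<epsilon>)\<^sup>2 * (norm g)\<^sup>2"
        unfolding power2_norm_eq_inner
        by (simp add: inner_add_left inner_add_right inner_commute power2_eq_square algebra_simps)
      moreover have "q (y1 + \<delta> *\<^sub>R h) = N * (norm (p + (\<delta> * \<epsilon>) *\<^sub>R g))\<^sup>2 - (\<delta> - s)"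
        by (simp only: q_def Ph ip)
      ultimately have "q (y1 + \<delta> *\<^sub>R h) - q y1
          = N * (2 * (\<delta> * \<epsilon>) * (p \<bullet> g) + (\<delta> * \<epsilon>)\<^sup>2 * (norm g)\<^sup>2) - \<delta>"
        unfolding qy1 by (simp add: algebra_simps)
      also have "\<dots> = \<delta> * (2 * N * (p \<bullet> g) * \<epsilon> + \<delta> * (N * \<epsilon>\<^sup>2 * (norm g)\<^sup>2) - 1)"
        by (simp add: power2_eq_square algebra_simps)
      also have "\<dots> < 0"
        using elim \<epsilon>2 by (intro mult_pos_neg) auto
      finally show ?case
        using elim Ph ip by (intro below) auto
    qed
    then have "g \<bullet> h \<le> 0"
      by (rule entering_direction_descends[OF X(1) y1f ldf g(1)])
    moreover have "g \<bullet> g > 0" using g(2) by simp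
    ultimately show False
      using g\<theta> \<epsilon> by (simp add: h_def inner_add_right mult_le_0_iff)
  qed
  with le have "g \<bullet> \<theta> < 0" by simp
  then have "\<theta> \<bullet> outer_normal X y1 < 0"
    using outer_normal_eq[OF X(1) y1f ldf g(1)] g(2)
    by (simp add: sgn_div_norm inner_commute mult_pos_neg)
  then have "(y1, \<theta>) \<in> Gamma_minus X"
    using y1f \<theta> by (simp add: Gamma_minus_def)
  moreover have "s \<le> diameter X"
  proof -
    have "dist x1 y1 \<le> diameter (closure X)"
      using x1X y1f X(2) closure_subset[of X]
      by (intro diameter_bounded_bound) (auto simp: frontier_def)
    moreover have "dist x1 y1 = s"
      using s \<theta> by (simp add: y1_eq dist_norm)
    ultimately show ?thesis
      using diameter_closure[OF X(2)] by simp
  qed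
  moreover have "dist x1 x0 < e"
    using pr r(2) by (simp add: x1_def dist_norm)
  ultimately show ?thesis
    using that[OF x1X _ s] inside y1_eq by blast
qed

section \<open>Transport along characteristics\<close>

text \<open>If the bound failed, \<open>w\<close> would be positive after the last zero of \<open>w - B t\<close> before \<open>s\<close>, and
  from there on it could not grow faster than \<open>B t\<close>. The bound on \<open>w'\<close> is only required where \<open>w > 0\<close>, which lets the absorption term
  be discarded by its sign.\<close>

lemma transport_ode_bound:
  fixes w :: "real \<Rightarrow> real"
  assumes der: "\<And>t. 0 < t \<Longrightarrow> t \<le> s \<Longrightarrow> (w has_real_derivative w' t) (at t)"
    and le: "\<And>t. 0 < t \<Longrightarrow> t \<le> s \<Longrightarrow> w t > 0 \<Longrightarrow> w' t \<le> B"
    and lim: "(w \<longlongrightarrow> 0) (at_right 0)" and s: "s > 0" and B: "B \<ge> 0"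
  shows "w s \<le> B * s"
proof (rule ccontr)
  assume "\<not> w s \<le> B * s"
  then have ws: "w s > B * s" by simp
  \<comment> \<open>Nothing is known about \<open>w 0\<close>; the limit from the right takes its place.\<close>
  define h where "h t = (if t \<le> 0 then 0 else w t) - B * t" for t
  have hs: "h s > 0" using ws s by (simp add: h_def)
  have cont: "continuous_on {0..s} h"
  proof -
    have "continuous_on {0..s} (\<lambda>t. if t \<le> 0 then 0 else w t)"
      unfolding continuous_on_def
    proof
      fix t assume t: "t \<in> {0..s}"
      show "((\<lambda>t. if t \<le> 0 then 0 else w t) \<longlongrightarrow> (if t \<le> 0 then 0 else w t)) (at t within {0..s})"
      proof (cases "t = 0")
        case True
        have "((\<lambda>t. if t \<le> 0 then 0 else w t) \<longlongrightarrow> 0) (at_right 0)"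
          using lim by (rule Lim_transform_eventually)
            (auto simp: eventually_at_right_field intro: exI[of _ 1])
        then show ?thesis
          using True s by (simp add: at_within_Icc_at_right)
      next
        case False
        then have t0: "t > 0" using t by simp
        have "isCont w t" using der[OF t0] t by (auto intro: DERIV_isCont)
        then have "(w \<longlongrightarrow> w t) (at t within {0..s})"
          by (simp add: continuous_at_imp_continuous_at_within continuous_within[symmetric])
        moreover have "\<forall>\<^sub>F x in at t within {0..s}. w x = (if x \<le> 0 then 0 else w x)"
          using eventually_at_ball[OF t0, of t "{0..s}"]
          by (rule eventually_mono) (auto simp: dist_real_def)
        ultimately show ?thesis
          using t0 by (auto intro: Lim_transform_eventually)
      qed
    qed
    then show ?thesis unfolding h_def by (intro continuous_intros)
  qed
  define Z where "Z = {t\<in>{0..s}. h t \<le> 0}"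
  have "compact Z"
    unfolding Z_def using continuous_closed_preimage[OF cont, of "{..0}"]
    by (simp add: compact_eq_bounded_closed vimage_def Int_def bounded_subset[OF bounded_closed_interval[of 0 s]] subset_eq)
  moreover have "0 \<in> Z" using s by (simp add: Z_def h_def)
  ultimately obtain t0 where t0: "t0 \<in> Z" "\<And>t. t \<in> Z \<Longrightarrow> t \<le> t0"
    using compact_attains_sup[of Z] by blast
  have t0s: "t0 < s" "0 \<le> t0" "h t0 \<le> 0" using t0(1) hs
    by (auto simp: Z_def less_le)
  have pos: "h t > 0" if "t0 < t" "t \<le> s" for t
    using t0(2)[of t] that t0s(2) by (force simp: Z_def)
  have "h s \<le> h t0"
  proof (rule DERIV_nonpos_imp_decreasing_open[of t0 s h])
    show "t0 \<le> s" using t0s by simp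
    show "continuous_on {t0..s} h" using cont by (rule continuous_on_subset) (use t0s in auto)
    fix t assume t: "t0 < t" "t < s"
    then have tp: "t > 0" using t0s by simp
    have "w t > 0" using pos[of t] t tp mult_nonneg_nonneg[OF B, of t] by (simp add: h_def)
    then have "w' t - B \<le> 0" using le[of t] tp t by simp
    moreover have "(h has_real_derivative (w' t - B)) (at t)"
    proof -
      have "((\<lambda>t. w t - B * t) has_real_derivative (w' t - B)) (at t)"
        by (rule derivative_eq_intros der tp order_less_imp_le t refl | simp)+
      moreover have "\<forall>\<^sub>F x in nhds t. w x - B * x = h x"
        using eventually_nhds_in_open[of "{0<..}" t] tp
        by (auto simp: h_def elim!: eventually_mono)
      ultimately show ?thesis using tp
        by (subst DERIV_cong_ev[OF refl _ refl, symmetric]) auto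
    qed
    ultimately show "\<exists>y. (h has_real_derivative y) (at t) \<and> y \<le> 0" by blast
  qed
  with hs t0s show False by simp
qed

text \<open>Along a characteristic that starts at a point of \<open>\<Gamma>\<^sub>-\<close> the solution grows from \<open>0\<close> at rate at most \<open>B\<close>
  over a length of at most \<open>diameter X\<close>. The points on such characteristics are dense, and \<open>w\<close> is continuous.\<close>

lemma characteristic_bound:
  fixes X :: "(real^'n) set" and w :: "real^'n \<Rightarrow> real"
  assumes X: "open X" "bounded X" "smooth_boundary X" and \<theta>: "norm \<theta> = 1"
    and \<sigma>: "\<And>x. x \<in> X \<Longrightarrow> 0 \<le> \<sigma> x"
    and cont: "continuous_on X w"
    and eq: "\<And>x. x \<in> X \<Longrightarrow> \<exists>D. ((\<lambda>t. w (x + t *\<^sub>R \<theta>)) has_real_derivative D) (at 0) \<and>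
              D + \<sigma> x * w x = F x"
    and bc: "\<And>y. (y, \<theta>) \<in> Gamma_minus X \<Longrightarrow> ((\<lambda>t. w (y + t *\<^sub>R \<theta>)) \<longlongrightarrow> 0) (at_right 0)"
    and B: "\<And>x. x \<in> X \<Longrightarrow> \<bar>F x\<bar> \<le> B"
    and x: "x \<in> X"
  shows "\<bar>w x\<bar> \<le> diameter X * B"
proof -
  have B0: "B \<ge> 0" using B[OF x] by simp
  have one_sided: "w z \<le> B * s \<and> - w z \<le> B * s"
    if z: "z \<in> X" "0 < s" "\<And>t. 0 \<le> t \<Longrightarrow> t < s \<Longrightarrow> z - t *\<^sub>R \<theta> \<in> X"
      "(z - s *\<^sub>R \<theta>, \<theta>) \<in> Gamma_minus X" for z s
  proof -
    define y where "y = z - s *\<^sub>R \<theta>"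
    define W where "W t = w (y + t *\<^sub>R \<theta>)" for t
    have yX: "y + t *\<^sub>R \<theta> \<in> X" if "0 < t" "t \<le> s" for t
      using z(3)[of "s - t"] that by (simp add: y_def algebra_simps)
    have der: "(W has_real_derivative (F (y + t *\<^sub>R \<theta>) - \<sigma> (y + t *\<^sub>R \<theta>) * W t)) (at t)"
      if t: "0 < t" "t \<le> s" for t
    proof -
      obtain D where D: "((\<lambda>\<tau>. w (y + t *\<^sub>R \<theta> + \<tau> *\<^sub>R \<theta>)) has_real_derivative D) (at 0)"
        "D + \<sigma> (y + t *\<^sub>R \<theta>) * w (y + t *\<^sub>R \<theta>) = F (y + t *\<^sub>R \<theta>)"
        using eq[OF yX[OF t]] by blast
      have "(\<lambda>\<tau>. w (y + t *\<^sub>R \<theta> + \<tau> *\<^sub>R \<theta>)) = (\<lambda>\<tau>. W (\<tau> + t))"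
        by (simp add: W_def algebra_simps)
      then have "(W has_real_derivative D) (at (0 + t))"
        using D(1) by (subst DERIV_shift) simp
      moreover have "D = F (y + t *\<^sub>R \<theta>) - \<sigma> (y + t *\<^sub>R \<theta>) * W t"
        using D(2) by (simp add: W_def)
      ultimately show ?thesis by simp
    qed
    have lim: "(W \<longlongrightarrow> 0) (at_right 0)"
      unfolding W_def y_def by (rule bc[OF z(4)])
    have ws: "W s = w z" by (simp add: W_def y_def)
    have "W s \<le> B * s"
    proof (rule transport_ode_bound[OF der _ lim z(2) B0])
      fix t assume t: "0 < t" "t \<le> s" "0 < W t"
      show "F (y + t *\<^sub>R \<theta>) - \<sigma> (y + t *\<^sub>R \<theta>) * W t \<le> B"
        using B[OF yX[OF t(1,2)]] mult_nonneg_nonneg[OF \<sigma>[OF yX[OF t(1,2)]], of "W t"] t(3) by linarith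
    qed
    moreover have "- W s \<le> B * s"
    proof (rule transport_ode_bound[OF _ _ _ z(2) B0])
      show "((\<lambda>t. - W t) has_real_derivative - (F (y + t *\<^sub>R \<theta>) - \<sigma> (y + t *\<^sub>R \<theta>) * W t)) (at t)"
        if "0 < t" "t \<le> s" for t
        using der[OF that] by (rule DERIV_minus)
      show "((\<lambda>t. - W t) \<longlongrightarrow> 0) (at_right 0)"
        using tendsto_minus[OF lim] by simp
      fix t assume t: "0 < t" "t \<le> s" "0 < - W t"
      show "- (F (y + t *\<^sub>R \<theta>) - \<sigma> (y + t *\<^sub>R \<theta>) * W t) \<le> B"
        using B[OF yX[OF t(1,2)]] mult_nonneg_nonneg[OF \<sigma>[OF yX[OF t(1,2)]], of "- W t"] t(3)
        by (simp add: abs_le_iff)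
    qed
    ultimately show ?thesis using ws by simp
  qed
  have near: "\<exists>z\<in>X. dist z x < e \<and> \<bar>w z\<bar> \<le> diameter X * B" if e: "e > 0" for e
  proof -
    obtain z s where z: "z \<in> X" "dist z x < e" "0 < s" "s \<le> diameter X"
      "\<And>t. 0 \<le> t \<Longrightarrow> t < s \<Longrightarrow> z - t *\<^sub>R \<theta> \<in> X" "(z - s *\<^sub>R \<theta>, \<theta>) \<in> Gamma_minus X"
      using transversal_exit_dense[OF X \<theta> x e] by metis
    have "\<bar>w z\<bar> \<le> B * s" using one_sided[OF z(1,3,5,6)] by (simp add: abs_le_iff)
    also have "\<dots> \<le> diameter X * B"
      using mult_left_mono[OF z(4) B0] by (simp add: mult.commute)
    finally show ?thesis using z by blast
  qed
  show ?thesis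
  proof (rule ccontr)
    assume "\<not> \<bar>w x\<bar> \<le> diameter X * B"
    then have gap: "\<bar>w x\<bar> - diameter X * B > 0" by simp
    obtain d where d: "d > 0" "\<And>z. z \<in> X \<Longrightarrow> dist z x < d \<Longrightarrow> dist (w z) (w x) < \<bar>w x\<bar> - diameter X * B"
      using cont x gap unfolding continuous_on_iff by blast
    obtain z where "z \<in> X" "dist z x < d" "\<bar>w z\<bar> \<le> diameter X * B"
      using near[OF d(1)] by blast
    with d(2)[of z] show False by (simp add: dist_real_def)
  qed
qed

section \<open>Integration over the sphere\<close>

lemma sets_sphere_measure: "sets (sphere_measure :: (real^'n) measure) = sets (restrict_space borel usphere)"
  by (simp add: sphere_measure_def)

lemma space_sphere_measure: "space (sphere_measure :: (real^'n) measure) = usphere"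
  by (simp add: sphere_measure_def space_scale_measure space_restrict_space)

lemma sgn_measurable_sphere:
  "sgn \<in> restrict_space lborel (ball 0 1 - {0 :: real^'n}) \<rightarrow>\<^sub>M restrict_space borel usphere"
proof (rule measurable_restrict_space2)
  show "sgn \<in> space (restrict_space lborel (ball 0 1 - {0 :: real^'n})) \<rightarrow> usphere"
    by (auto simp: space_restrict_space norm_sgn)
  have "(\<lambda>x :: real^'n. sgn x) = (\<lambda>x. inverse (norm x) *\<^sub>R x)"
    by (simp add: sgn_div_norm fun_eq_iff)
  then have "(sgn :: real^'n \<Rightarrow> real^'n) \<in> borel_measurable borel" by simp
  then show "(sgn :: real^'n \<Rightarrow> real^'n) \<in> borel_measurable (restrict_space lborel (ball 0 1 - {0}))"
    by (intro measurable_restrict_space1) simp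
qed

lemma finite_sphere_measure: "finite_measure (sphere_measure :: (real^'n) measure)"
proof (rule finite_measureI)
  let ?B = "ball 0 1 - {0 :: real^'n}"
  have S: "(usphere :: (real^'n) set) \<in> sets (restrict_space borel usphere)"
    by (simp add: sets_restrict_space_iff)
  have "emeasure (distr (restrict_space lborel ?B) (restrict_space borel usphere) sgn) usphere
      \<le> emeasure (restrict_space lborel ?B) (space (restrict_space lborel ?B))"
    by (subst emeasure_distr[OF sgn_measurable_sphere S]) (rule emeasure_space)
  also have "\<dots> = emeasure lborel ?B"
    by (simp add: emeasure_restrict_space space_restrict_space)
  also have "\<dots> \<le> emeasure lborel (ball 0 1 :: (real^'n) set)"
    by (rule emeasure_mono) auto
  also have "\<dots> < \<infinity>" by (rule emeasure_lborel_ball_finite)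
  finally have "emeasure (sphere_measure :: (real^'n) measure) usphere < \<infinity>"
    by (simp add: sphere_measure_def ennreal_mult_less_top of_nat_less_top)
  then show "emeasure (sphere_measure :: (real^'n) measure) (space sphere_measure) \<noteq> \<infinity>"
    by (simp add: space_sphere_measure)
qed

interpretation sphere: finite_measure "sphere_measure :: (real^'n) measure"
  by (rule finite_sphere_measure)

lemma continuous_on_sphere_measurable:
  assumes "continuous_on usphere (f :: real^'n \<Rightarrow> real)"
  shows "f \<in> borel_measurable sphere_measure"
  using borel_measurable_continuous_on_restrict[OF assms]
  by (simp add: measurable_cong_sets[OF sets_sphere_measure refl])

lemma (in finite_measure) abs_integral_le_const:
  fixes F :: "'a \<Rightarrow> real"
  assumes "F \<in> borel_measurable M" "AE x in M. \<bar>F x\<bar> \<le> B"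
  shows "\<bar>\<integral>x. F x \<partial>M\<bar> \<le> B * measure M (space M)"
proof -
  have int: "integrable M F"
    using assms by (intro integrable_const_bound[where B = B]) auto
  have "\<bar>\<integral>x. F x \<partial>M\<bar> \<le> (\<integral>x. \<bar>F x\<bar> \<partial>M)"
    by (rule integral_abs_bound)
  also have "\<dots> \<le> (\<integral>x. B \<partial>M)"
    using int assms(2) by (intro integral_mono_AE) auto
  also have "\<dots> = B * measure M (space M)" by simp
  finally show ?thesis .
qed

lemma (in finite_measure) continuous_on_parameter_integral:
  fixes F :: "'b::metric_space \<Rightarrow> 'a \<Rightarrow> real"
  assumes meas: "\<And>z. z \<in> A \<Longrightarrow> F z \<in> borel_measurable M"
    and ae: "AE x in M. continuous_on A (\<lambda>z. F z x) \<and> (\<forall>z\<in>A. \<bar>F z x\<bar> \<le> B)"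
  shows "continuous_on A (\<lambda>z. \<integral>x. F z x \<partial>M)"
  unfolding continuous_on_sequentially comp_def
proof (intro allI ballI impI)
  fix X a assume a: "a \<in> A" and X: "(\<forall>n::nat. X n \<in> A) \<and> X \<longlonglongrightarrow> a"
  show "(\<lambda>n. \<integral>x. F (X n) x \<partial>M) \<longlonglongrightarrow> (\<integral>x. F a x \<partial>M)"
  proof (rule integral_dominated_convergence[where w = "\<lambda>_. B"])
    show "F a \<in> borel_measurable M" "\<And>i. F (X i) \<in> borel_measurable M"
      using X a by (auto intro: meas)
    show "AE x in M. (\<lambda>n. F (X n) x) \<longlonglongrightarrow> F a x"
      using ae
    proof eventually_elim
      case (elim x)
      then show ?case using X a unfolding continuous_on_sequentially comp_def by blast
    qed
    show "AE x in M. norm (F (X i) x) \<le> B" for i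
      using ae by eventually_elim (use X in auto)
  qed simp
qed

text \<open>The infimum that defines the norm is attained, because a countable union of null sets is null.
  The constant \<open>C\<close> ensures that the infimum is taken over a nonempty set.\<close>

lemma AE_le_Linf_norm:
  assumes "0 \<le> C" "AE z in M. \<bar>f z\<bar> \<le> C"
  shows "AE z in M. \<bar>f z\<bar> \<le> Linf_norm M f" "0 \<le> Linf_norm M f"
proof -
  let ?A = "{C. 0 \<le> C \<and> (AE z in M. \<bar>f z\<bar> \<le> C)}"
  have ne: "?A \<noteq> {}" using assms by auto
  have "AE z in M. \<forall>n::nat. \<bar>f z\<bar> \<le> Linf_norm M f + 1 / real (Suc n)"
    unfolding AE_all_countable
  proof
    fix n :: nat
    have "Inf ?A < Linf_norm M f + 1 / real (Suc n)"
      by (simp add: Linf_norm_def)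
    then obtain D where "D \<in> ?A" "D < Linf_norm M f + 1 / real (Suc n)"
      using cInf_lessD[OF ne] by blast
    then show "AE z in M. \<bar>f z\<bar> \<le> Linf_norm M f + 1 / real (Suc n)"
      by (auto elim!: eventually_mono)
  qed
  then show "AE z in M. \<bar>f z\<bar> \<le> Linf_norm M f"
  proof eventually_elim
    case (elim z)
    have "(\<lambda>n. Linf_norm M f + 1 / real (Suc n)) \<longlonglongrightarrow> Linf_norm M f + 0"
      by (intro tendsto_add tendsto_const LIMSEQ_Suc lim_1_over_n)
    then show ?case using elim by (intro LIMSEQ_le_const[where X = "\<lambda>n. Linf_norm M f + 1 / real (Suc n)"]) auto
  qed
  show "0 \<le> Linf_norm M f"
    unfolding Linf_norm_def using ne by (intro cInf_greatest) auto
qed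

lemma open_subset_closure_of_AE:
  fixes X :: "'a::euclidean_space set"
  assumes "open X" "AE x in lborel. x \<in> X \<longrightarrow> P x"
  shows "X \<subseteq> closure {x\<in>X. P x}"
proof (rule ccontr)
  let ?V = "X - closure {x\<in>X. P x}"
  assume "\<not> X \<subseteq> closure {x\<in>X. P x}"
  then have ne: "?V \<noteq> {}" by auto
  have op: "open ?V" using assms(1) by (intro open_Diff) auto
  obtain N where N: "N \<in> null_sets lborel" "{x\<in>space lborel. \<not> (x \<in> X \<longrightarrow> P x)} \<subseteq> N"
    using assms(2) by (auto elim!: AE_E simp: null_sets_def)
  have "?V \<subseteq> N"
    using N(2) closure_subset[of "{x\<in>X. P x}"] by auto
  moreover have "negligible N"
    using N(1) by (simp add: negligible_iff_null_sets null_sets_completionI)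
  ultimately have "negligible ?V" by (metis negligible_subset)
  with open_not_negligible[OF op ne] show False by simp
qed

text \<open>A bound that holds almost everywhere on \<open>X \<times> M\<close> holds for almost every \<open>y\<close> at all points of a countable
  dense subset of \<open>X\<close>, and by continuity in \<open>x\<close> at all points of \<open>X\<close>. The exceptional null set of
  \<open>y\<close> is then independent of \<open>x\<close>, so that the bound can be used along a whole characteristic.\<close>

lemma AE_slice_le_of_AE_product:
  fixes X :: "'a::euclidean_space set" and J :: "'a \<Rightarrow> 'b \<Rightarrow> real"
  assumes X: "open X" and M: "sigma_finite_measure M"
    and cont: "\<And>y. y \<in> space M \<Longrightarrow> continuous_on X (\<lambda>x. J x y)"
    and ae: "AE z in restrict_space lborel X \<Otimes>\<^sub>M M. (case z of (x, y) \<Rightarrow> J x y) \<le> C"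
  shows "AE y in M. \<forall>x\<in>X. J x y \<le> C"
proof -
  interpret M: sigma_finite_measure M by fact
  have Xs: "X \<in> sets lborel" using X by simp
  interpret L: sigma_finite_measure "restrict_space lborel X"
    using Xs by (intro sigma_finite_measure_restrict_space sigma_finite_lborel) auto
  interpret P: pair_sigma_finite "restrict_space lborel X" M ..
  define G where "G = {x\<in>X. AE y in M. J x y \<le> C}"
  have "AE x in restrict_space lborel X. AE y in M. J x y \<le> C"
    using P.AE_pair[OF ae] by simp
  then have "AE x in lborel. x \<in> X \<longrightarrow> (AE y in M. J x y \<le> C)"
    using Xs by (simp add: AE_restrict_space_iff)
  then have XG: "X \<subseteq> closure G"
    unfolding G_def by (rule open_subset_closure_of_AE[OF X])
  obtain D where D: "countable D" "D \<subseteq> G" "G \<subseteq> closure D"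
    using separable by metis
  have "AE y in M. \<forall>x\<in>D. J x y \<le> C"
    using D by (subst AE_ball_countable) (auto simp: G_def)
  then show ?thesis
    using AE_space
  proof eventually_elim
    case (elim y)
    show ?case
    proof
      fix x assume x: "x \<in> X"
      have "x \<in> closure D"
        using x XG closure_mono[OF D(3)] by auto
      then obtain d where d: "\<And>n. d n \<in> D" "d \<longlonglongrightarrow> x"
        unfolding closure_sequential by auto
      have "(\<lambda>n. J (d n) y) \<longlonglongrightarrow> J x y"
        using cont[OF elim(2)] x d D(2) unfolding continuous_on_sequentially comp_def
        by (auto simp: G_def subset_eq)
      then show "J x y \<le> C"
        using elim(1) d(1) by (intro LIMSEQ_le_const2[where X = "\<lambda>n. J (d n) y"]) auto
    qed
  qed
qed

section \<open>A priori estimate for the forward problem\<close>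

definition scattering ::
  "(real^'n \<Rightarrow> real^'n \<Rightarrow> real^'n \<Rightarrow> real) \<Rightarrow> (real^'n \<Rightarrow> real^'n \<Rightarrow> real) \<Rightarrow> real^'n \<Rightarrow> real^'n \<Rightarrow> real"
  where "scattering k u x \<theta> = (\<integral>\<theta>'. k x \<theta> \<theta>' * u x \<theta>' \<partial>sphere_measure)"

text \<open>The essentially bounded elements of \<open>LpC\<close>. The explicit bound makes the class stable under
  linear combinations and lets the bound be improved in steps.\<close>

definition ess_bounded_on :: "(real^'n) set \<Rightarrow> real \<Rightarrow> (real^'n \<Rightarrow> real^'n \<Rightarrow> real) \<Rightarrow> bool" where
  "ess_bounded_on X C u \<longleftrightarrow> (\<forall>x\<in>X. u x \<in> borel_measurable sphere_measure) \<and>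
     (AE \<theta> in sphere_measure. continuous_on X (\<lambda>x. u x \<theta>) \<and> (\<forall>x\<in>X. \<bar>u x \<theta>\<bar> \<le> C))"

lemma ess_bounded_on_AE:
  assumes "ess_bounded_on X C u" "x \<in> X"
  shows "u x \<in> borel_measurable sphere_measure" "AE \<theta> in sphere_measure. \<bar>u x \<theta>\<bar> \<le> C"
proof -
  show "u x \<in> borel_measurable sphere_measure"
    using assms by (simp add: ess_bounded_on_def)
  have "AE \<theta> in sphere_measure. continuous_on X (\<lambda>x. u x \<theta>) \<and> (\<forall>x\<in>X. \<bar>u x \<theta>\<bar> \<le> C)"
    using assms(1) by (simp add: ess_bounded_on_def)
  then show "AE \<theta> in sphere_measure. \<bar>u x \<theta>\<bar> \<le> C"
    by eventually_elim (use assms(2) in blast)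
qed

lemma ess_bounded_on_lincomb:
  assumes u: "ess_bounded_on X C u" and w: "ess_bounded_on X D w"
  shows "ess_bounded_on X (\<bar>a\<bar> * C + \<bar>b\<bar> * D) (\<lambda>x \<theta>. a * u x \<theta> + b * w x \<theta>)"
  unfolding ess_bounded_on_def
proof (intro conjI ballI)
  fix x assume "x \<in> X"
  then show "(\<lambda>\<theta>. a * u x \<theta> + b * w x \<theta>) \<in> borel_measurable sphere_measure"
    using u w unfolding ess_bounded_on_def
    by (intro borel_measurable_add borel_measurable_times borel_measurable_const) auto
next
  have "AE \<theta> in sphere_measure. continuous_on X (\<lambda>x. u x \<theta>) \<and> (\<forall>x\<in>X. \<bar>u x \<theta>\<bar> \<le> C)"
    "AE \<theta> in sphere_measure. continuous_on X (\<lambda>x. w x \<theta>) \<and> (\<forall>x\<in>X. \<bar>w x \<theta>\<bar> \<le> D)"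
    using u w by (auto simp: ess_bounded_on_def)
  then show "AE \<theta> in sphere_measure. continuous_on X (\<lambda>x. a * u x \<theta> + b * w x \<theta>) \<and>
      (\<forall>x\<in>X. \<bar>a * u x \<theta> + b * w x \<theta>\<bar> \<le> \<bar>a\<bar> * C + \<bar>b\<bar> * D)"
  proof eventually_elim
    case (elim \<theta>)
    have "\<bar>a * u x \<theta> + b * w x \<theta>\<bar> \<le> \<bar>a\<bar> * C + \<bar>b\<bar> * D" if "x \<in> X" for x
    proof -
      have "\<bar>a * u x \<theta>\<bar> \<le> \<bar>a\<bar> * C" "\<bar>b * w x \<theta>\<bar> \<le> \<bar>b\<bar> * D"
        using elim that by (auto simp: abs_mult intro!: mult_left_mono)
      then show ?thesis by linarith
    qed
    then show ?case using elim by (auto intro!: continuous_intros)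
  qed
qed

locale transport_medium =
  fixes X :: "(real^'n) set" and \<sigma> :: "real^'n \<Rightarrow> real"
    and k :: "real^'n \<Rightarrow> real^'n \<Rightarrow> real^'n \<Rightarrow> real"
  assumes open_X: "open X" and bounded_X: "bounded X" and smooth_X: "smooth_boundary X"
    and sigma_cont: "continuous_on (closure X) \<sigma>"
    and sigma_nonneg: "x \<in> closure X \<Longrightarrow> 0 \<le> \<sigma> x"
    and k_cont: "continuous_on (closure X \<times> usphere \<times> usphere) (\<lambda>(x, \<theta>, \<theta>'). k x \<theta> \<theta>')"
    and k_nonneg: "x \<in> closure X \<Longrightarrow> \<theta> \<in> usphere \<Longrightarrow> \<theta>' \<in> usphere \<Longrightarrow> 0 \<le> k x \<theta> \<theta>'"
begin

lemma in_closure: "x \<in> X \<Longrightarrow> x \<in> closure X"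
  using closure_subset by blast

lemma sigma_bounded:
  assumes "x \<in> X" shows "\<bar>\<sigma> x\<bar> \<le> sup_norm X \<sigma>"
proof (rule abs_le_sup_norm[OF _ assms])
  have "bounded (\<sigma> ` closure X)"
    using bounded_X sigma_cont by (intro compact_imp_bounded compact_continuous_image) auto
  then show "\<sigma> \<in> Cb X"
    using sigma_cont closure_subset[of X]
    by (auto simp: Cb_def intro: continuous_on_subset bounded_subset)
qed

lemma kernel_bounded:
  obtains K where "0 \<le> K"
    "\<And>x \<theta> \<theta>'. x \<in> X \<Longrightarrow> \<theta> \<in> usphere \<Longrightarrow> \<theta>' \<in> usphere \<Longrightarrow> \<bar>k x \<theta> \<theta>'\<bar> \<le> K"
proof -
  have "bounded ((\<lambda>(x, \<theta>, \<theta>'). k x \<theta> \<theta>') ` (closure X \<times> usphere \<times> usphere))"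
    using bounded_X k_cont
    by (intro compact_imp_bounded compact_continuous_image compact_Times) auto
  then obtain K where "\<And>z. z \<in> closure X \<times> usphere \<times> usphere \<Longrightarrow> \<bar>(\<lambda>(x, \<theta>, \<theta>'). k x \<theta> \<theta>') z\<bar> \<le> K"
    by (auto simp: bounded_real)
  then have "\<bar>k x \<theta> \<theta>'\<bar> \<le> max 0 K" if "x \<in> X" "\<theta> \<in> usphere" "\<theta>' \<in> usphere" for x \<theta> \<theta>'
    using in_closure that by fastforce
  then show ?thesis using that[of "max 0 K"] by simp
qed

lemma kernel_measurable:
  assumes "x \<in> X" "\<theta> \<in> usphere"
  shows "(\<lambda>\<theta>'. k x \<theta> \<theta>') \<in> borel_measurable sphere_measure"
proof (rule continuous_on_sphere_measurable)
  have "continuous_on usphere (\<lambda>\<theta>'. (x, \<theta>, \<theta>'))" by (intro continuous_intros)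
  moreover have "(\<lambda>\<theta>'. (x, \<theta>, \<theta>')) ` usphere \<subseteq> closure X \<times> usphere \<times> usphere"
    using assms in_closure by auto
  ultimately show "continuous_on usphere (\<lambda>\<theta>'. k x \<theta> \<theta>')"
    using continuous_on_compose2[OF k_cont, of usphere "\<lambda>\<theta>'. (x, \<theta>, \<theta>')"] by simp
qed

lemma kernel_continuous:
  assumes "\<theta>' \<in> usphere"
  shows "continuous_on (X \<times> usphere) (\<lambda>(x, \<theta>). k x \<theta> \<theta>')"
proof -
  have "continuous_on (X \<times> usphere) (\<lambda>z. (fst z, snd z, \<theta>'))" by (intro continuous_intros)
  moreover have "(\<lambda>z. (fst z, snd z, \<theta>')) ` (X \<times> usphere) \<subseteq> closure X \<times> usphere \<times> usphere"
    using assms in_closure by auto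
  ultimately show ?thesis
    using continuous_on_compose2[OF k_cont, of "X \<times> usphere" "\<lambda>z. (fst z, snd z, \<theta>')"]
    by (simp add: case_prod_unfold)
qed

lemma AE_kernel_mult_bound:
  assumes u: "ess_bounded_on X C u" and x: "x \<in> X" and \<theta>: "\<theta> \<in> usphere"
  shows "AE \<theta>' in sphere_measure. \<bar>k x \<theta> \<theta>' * u x \<theta>'\<bar> \<le> C * k x \<theta> \<theta>'"
  using ess_bounded_on_AE(2)[OF u x] AE_space
proof eventually_elim
  case (elim \<theta>')
  then have "0 \<le> k x \<theta> \<theta>'"
    using k_nonneg[OF in_closure[OF x] \<theta>] by (simp add: space_sphere_measure)
  then show ?case
    using elim(1) mult_right_mono[of "\<bar>u x \<theta>'\<bar>" C "k x \<theta> \<theta>'"] by (simp add: abs_mult mult.commute)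
qed

lemma kernel_integrable:
  assumes x: "x \<in> X" and \<theta>: "\<theta> \<in> usphere"
  shows "integrable sphere_measure (\<lambda>\<theta>'. k x \<theta> \<theta>')"
proof -
  obtain K where K: "\<And>x \<theta> \<theta>'. x \<in> X \<Longrightarrow> \<theta> \<in> usphere \<Longrightarrow> \<theta>' \<in> usphere \<Longrightarrow> \<bar>k x \<theta> \<theta>'\<bar> \<le> K"
    using kernel_bounded by metis
  show ?thesis
  proof (rule sphere.integrable_const_bound)
    show "AE \<theta>' in sphere_measure. norm (k x \<theta> \<theta>') \<le> K"
      using AE_space by eventually_elim (use K x \<theta> in \<open>auto simp: space_sphere_measure\<close>)
  qed (rule kernel_measurable[OF x \<theta>])
qed

lemma kernel_mult_measurable:
  assumes u: "ess_bounded_on X C u" and x: "x \<in> X" and \<theta>: "\<theta> \<in> usphere"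
  shows "(\<lambda>\<theta>'. k x \<theta> \<theta>' * u x \<theta>') \<in> borel_measurable sphere_measure"
  by (intro borel_measurable_times kernel_measurable[OF x \<theta>] ess_bounded_on_AE(1)[OF u x])

lemma kernel_mult_integrable:
  assumes u: "ess_bounded_on X C u" and x: "x \<in> X" and \<theta>: "\<theta> \<in> usphere"
  shows "integrable sphere_measure (\<lambda>\<theta>'. k x \<theta> \<theta>' * u x \<theta>')"
proof (rule Bochner_Integration.integrable_bound)
  show "integrable sphere_measure (\<lambda>\<theta>'. C * k x \<theta> \<theta>')"
    by (intro integrable_mult_right kernel_integrable[OF x \<theta>])
  show "AE \<theta>' in sphere_measure. norm (k x \<theta> \<theta>' * u x \<theta>') \<le> norm (C * k x \<theta> \<theta>')"
    using AE_kernel_mult_bound[OF u x \<theta>] by eventually_elim simp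
qed (rule kernel_mult_measurable[OF u x \<theta>])

lemma abs_scattering_le:
  assumes u: "ess_bounded_on X C u" and x: "x \<in> X" and \<theta>: "\<theta> \<in> usphere"
  shows "\<bar>scattering k u x \<theta>\<bar> \<le> C * (\<integral>\<theta>'. k x \<theta> \<theta>' \<partial>sphere_measure)"
proof -
  have "\<bar>scattering k u x \<theta>\<bar> \<le> (\<integral>\<theta>'. \<bar>k x \<theta> \<theta>' * u x \<theta>'\<bar> \<partial>sphere_measure)"
    unfolding scattering_def by (rule integral_abs_bound)
  also have "\<dots> \<le> (\<integral>\<theta>'. C * k x \<theta> \<theta>' \<partial>sphere_measure)"
    using kernel_mult_integrable[OF u x \<theta>] kernel_integrable[OF x \<theta>] AE_kernel_mult_bound[OF u x \<theta>]
    by (intro integral_mono_AE) auto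
  finally show ?thesis by simp
qed

lemma scattering_continuous:
  assumes u: "ess_bounded_on X C u"
  shows "continuous_on (X \<times> usphere) (\<lambda>(x, \<theta>). scattering k u x \<theta>)"
proof -
  obtain K where K0: "0 \<le> K"
    and K: "\<And>x \<theta> \<theta>'. x \<in> X \<Longrightarrow> \<theta> \<in> usphere \<Longrightarrow> \<theta>' \<in> usphere \<Longrightarrow> \<bar>k x \<theta> \<theta>'\<bar> \<le> K"
    using kernel_bounded by metis
  have "continuous_on (X \<times> usphere)
      (\<lambda>z. \<integral>\<theta>'. k (fst z) (snd z) \<theta>' * u (fst z) \<theta>' \<partial>sphere_measure)"
  proof (rule sphere.continuous_on_parameter_integral[where B = "K * C"])
    show "(\<lambda>\<theta>'. k (fst z) (snd z) \<theta>' * u (fst z) \<theta>') \<in> borel_measurable sphere_measure"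
      if "z \<in> X \<times> usphere" for z
      using that kernel_mult_measurable[OF u] by auto
    have "AE \<theta>' in sphere_measure. continuous_on X (\<lambda>x. u x \<theta>') \<and> (\<forall>x\<in>X. \<bar>u x \<theta>'\<bar> \<le> C)"
      using u by (simp add: ess_bounded_on_def)
    then show "AE \<theta>' in sphere_measure.
        continuous_on (X \<times> usphere) (\<lambda>z. k (fst z) (snd z) \<theta>' * u (fst z) \<theta>') \<and>
        (\<forall>z\<in>X \<times> usphere. \<bar>k (fst z) (snd z) \<theta>' * u (fst z) \<theta>'\<bar> \<le> K * C)"
      using AE_space
    proof eventually_elim
      case (elim \<theta>')
      then have \<theta>': "\<theta>' \<in> usphere" by (simp add: space_sphere_measure)
      have "continuous_on (X \<times> usphere) (\<lambda>z. u (fst z) \<theta>')"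
        using elim(1) by (intro continuous_on_compose2[of X "\<lambda>x. u x \<theta>'" _ fst])
          (auto intro!: continuous_intros)
      moreover have "continuous_on (X \<times> usphere) (\<lambda>z. k (fst z) (snd z) \<theta>')"
        using kernel_continuous[OF \<theta>'] by (simp add: case_prod_unfold)
      ultimately have "continuous_on (X \<times> usphere) (\<lambda>z. k (fst z) (snd z) \<theta>' * u (fst z) \<theta>')"
        by (intro continuous_on_mult)
      moreover have "\<bar>k x \<theta> \<theta>' * u x \<theta>'\<bar> \<le> K * C" if "x \<in> X" "\<theta> \<in> usphere" for x \<theta>
        using K[OF that \<theta>'] elim(1) that K0 by (auto simp: abs_mult intro!: mult_mono)
      ultimately show ?case by auto
    qed
  qed
  then show ?thesis by (simp add: scattering_def case_prod_unfold)
qed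

text \<open>The constant \<open>\<rho>\<close> only bounds the total scattering almost everywhere in \<open>(x, \<theta>)\<close>; continuity in \<open>x\<close>
  turns this, for almost every \<open>\<theta>\<close>, into a bound at every \<open>x\<close>.\<close>

lemma AE_total_scattering_le_rho:
  "AE \<theta> in sphere_measure. \<forall>x\<in>X. (\<integral>\<theta>'. k x \<theta> \<theta>' \<partial>sphere_measure) \<le> rho X k"
  and rho_nonneg: "0 \<le> rho X k"
proof -
  let ?J = "\<lambda>x \<theta>. \<integral>\<theta>'. k x \<theta> \<theta>' \<partial>sphere_measure"
  let ?M = "restrict_space lborel X \<Otimes>\<^sub>M (sphere_measure :: (real^'n) measure)"
  have one: "ess_bounded_on X 1 (\<lambda>_ _. 1)" by (simp add: ess_bounded_on_def)
  obtain K where K0: "0 \<le> K"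
    and K: "\<And>x \<theta> \<theta>'. x \<in> X \<Longrightarrow> \<theta> \<in> usphere \<Longrightarrow> \<theta>' \<in> usphere \<Longrightarrow> \<bar>k x \<theta> \<theta>'\<bar> \<le> K"
    using kernel_bounded by metis
  define C where "C = K * measure (sphere_measure :: (real^'n) measure) (space sphere_measure)"
  have C0: "0 \<le> C" using K0 by (simp add: C_def)
  have bound: "\<bar>?J x \<theta>\<bar> \<le> C" if "x \<in> X" "\<theta> \<in> usphere" for x \<theta>
    unfolding C_def
  proof (rule sphere.abs_integral_le_const)
    show "AE \<theta>' in sphere_measure. \<bar>k x \<theta> \<theta>'\<bar> \<le> K"
      using AE_space by eventually_elim (use K that in \<open>auto simp: space_sphere_measure\<close>)
  qed (rule kernel_measurable[OF that])
  have ae: "AE z in ?M. \<bar>(case z of (x, \<theta>) \<Rightarrow> ?J x \<theta>)\<bar> \<le> C"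
    using AE_space
    by eventually_elim
      (use bound in \<open>auto simp: space_pair_measure space_restrict_space space_sphere_measure\<close>)
  show "0 \<le> rho X k"
    unfolding rho_def by (rule AE_le_Linf_norm(2)[OF C0 ae])
  have "AE z in ?M. (case z of (x, \<theta>) \<Rightarrow> ?J x \<theta>) \<le> rho X k"
    using AE_le_Linf_norm(1)[OF C0 ae] unfolding rho_def by eventually_elim simp
  moreover have "continuous_on X (\<lambda>x. ?J x \<theta>)" if "\<theta> \<in> space sphere_measure" for \<theta>
  proof -
    have "continuous_on X (\<lambda>x. (\<lambda>(x, \<theta>). scattering k (\<lambda>_ _. 1) x \<theta>) (x, \<theta>))"
      using that by (intro continuous_on_compose2[OF scattering_continuous[OF one]] continuous_intros)
        (auto simp: space_sphere_measure)
    then show ?thesis by (simp add: scattering_def)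
  qed
  ultimately show "AE \<theta> in sphere_measure. \<forall>x\<in>X. ?J x \<theta> \<le> rho X k"
    by (intro AE_slice_le_of_AE_product[OF open_X]) (auto intro: sphere.sigma_finite_measure_axioms)
qed

lemma AE_scattering_le:
  assumes u: "ess_bounded_on X C u" and C: "0 \<le> C"
  shows "AE \<theta> in sphere_measure. \<forall>x\<in>X. \<bar>scattering k u x \<theta>\<bar> \<le> C * rho X k"
  using AE_total_scattering_le_rho AE_space
proof eventually_elim
  case (elim \<theta>)
  show ?case
  proof
    fix x assume x: "x \<in> X"
    have "\<bar>scattering k u x \<theta>\<bar> \<le> C * (\<integral>\<theta>'. k x \<theta> \<theta>' \<partial>sphere_measure)"
      using elim by (intro abs_scattering_le[OF u x]) (simp add: space_sphere_measure)
    also have "\<dots> \<le> C * rho X k" using elim(1) x C by (intro mult_left_mono) auto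
    finally show "\<bar>scattering k u x \<theta>\<bar> \<le> C * rho X k" .
  qed
qed

text \<open>The estimate along characteristics, with the scattered light treated as part of the source.\<close>

lemma forward_solution_le:
  assumes sol: "forward_solution X \<sigma> k f u"
    and cont: "AE \<theta> in sphere_measure. continuous_on X (\<lambda>x. u x \<theta>)"
    and B: "AE \<theta> in sphere_measure. \<forall>x\<in>X. \<bar>f x + scattering k u x \<theta>\<bar> \<le> B"
  shows "AE \<theta> in sphere_measure. \<forall>x\<in>X. \<bar>u x \<theta>\<bar> \<le> diameter X * B"
  using sol[unfolded forward_solution_def] cont B AE_space
proof eventually_elim
  case (elim \<theta>)
  have \<theta>: "norm \<theta> = 1" using elim(4) by (simp add: space_sphere_measure)
  show ?case
  proof
    fix x assume x: "x \<in> X"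
    show "\<bar>u x \<theta>\<bar> \<le> diameter X * B"
    proof (rule characteristic_bound[OF open_X bounded_X smooth_X \<theta>, where w = "\<lambda>x. u x \<theta>" and x = x])
      show "\<exists>D. ((\<lambda>t. u (y + t *\<^sub>R \<theta>) \<theta>) has_real_derivative D) (at 0) \<and>
          D + \<sigma> y * u y \<theta> = f y + scattering k u y \<theta>" if "y \<in> X" for y
        using elim(1) that by (auto simp: scattering_def algebra_simps)
      show "((\<lambda>t. u (y + t *\<^sub>R \<theta>) \<theta>) \<longlongrightarrow> 0) (at_right 0)" if "(y, \<theta>) \<in> Gamma_minus X" for y
        using elim(1) that by blast
    qed (use x elim sigma_nonneg in_closure in auto)
  qed
qed

text \<open>The characteristic estimate with a crude right-hand side. For finite \<open>p\<close> the \<open>L\<^sup>p\<close> bound gives an \<open>L\<^sup>1\<close> bound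
  on \<open>u x\<close> that is uniform in \<open>x\<close>; as the kernel is bounded, so is the scattering term, and therefore \<open>u\<close>.
  The \<open>L\<^sup>1\<close> bound rests on \<open>t \<le> 1 + t\<^sup>r\<close> for each fixed \<open>x\<close>, which avoids the question whether the
  supremum over \<open>x\<close> is measurable in \<open>\<theta>\<close>.\<close>

lemma ess_bounded_of_LpC:
  assumes sol: "forward_solution X \<sigma> k f u" and u: "u \<in> LpC p X" and p: "1 \<le> p"
    and F: "\<And>x. x \<in> X \<Longrightarrow> \<bar>f x\<bar> \<le> F" 
  obtains C where "0 \<le> C" "ess_bounded_on X C u"
proof -
  have meas: "u x \<in> borel_measurable sphere_measure" if "x \<in> X" for x
    using u that by (simp add: LpC_def)
  have Cb: "AE \<theta> in sphere_measure. (\<lambda>x. u x \<theta>) \<in> Cb X"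
    using u by (simp add: LpC_def)
  have *: "ess_bounded_on X (max 0 C) u" if "AE \<theta> in sphere_measure. \<forall>x\<in>X. \<bar>u x \<theta>\<bar> \<le> C" for C
    unfolding ess_bounded_on_def
  proof
    show "AE \<theta> in sphere_measure. continuous_on X (\<lambda>x. u x \<theta>) \<and> (\<forall>x\<in>X. \<bar>u x \<theta>\<bar> \<le> max 0 C)"
      using that Cb by eventually_elim (force simp: Cb_def)
  qed (use meas in auto)
  have "\<exists>C. AE \<theta> in sphere_measure. \<forall>x\<in>X. \<bar>u x \<theta>\<bar> \<le> C"
  proof (cases "p = \<infinity>")
    case True
    then obtain C where "AE \<theta> in sphere_measure. sup_norm X (\<lambda>x. u x \<theta>) \<le> C"
      using u by (auto simp: LpC_def)
    with Cb have "AE \<theta> in sphere_measure. \<forall>x\<in>X. \<bar>u x \<theta>\<bar> \<le> C"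
    proof eventually_elim
      case (elim \<theta>)
      then show ?case using abs_le_sup_norm[OF elim(1)] by (auto intro: order_trans)
    qed
    then show ?thesis by blast
  next
    case False
    define r where "r = enn2real p"
    have "p = ennreal r" using False by (simp add: r_def ennreal_enn2real_if)
    then have r: "1 \<le> r" using p by (cases "0 \<le> r") (auto simp: ennreal_neg ennreal_le_iff2 ennreal_1[symmetric] simp del: ennreal_1)
    define I where "I = (\<integral>\<^sup>+\<theta>. ennreal (sup_norm X (\<lambda>x. u x \<theta>) powr r) \<partial>(sphere_measure :: (real^'n) measure))"
    have I: "I < \<infinity>" using u False by (simp add: LpC_def I_def r_def)
    define B where "B = enn2real (emeasure (sphere_measure :: (real^'n) measure) (space sphere_measure) + I)"
    have L1: "integrable sphere_measure (u x) \<and> (\<integral>\<theta>. \<bar>u x \<theta>\<bar> \<partial>sphere_measure) \<le> B" if x: "x \<in> X" for x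
    proof -
      have m: "(\<lambda>\<theta>. \<bar>u x \<theta>\<bar> powr r) \<in> borel_measurable sphere_measure"
        using meas[OF x] by measurable
      have "(\<integral>\<^sup>+\<theta>. ennreal \<bar>u x \<theta>\<bar> \<partial>sphere_measure)
          \<le> (\<integral>\<^sup>+\<theta>. (1 + ennreal (\<bar>u x \<theta>\<bar> powr r)) \<partial>sphere_measure)"
      proof (rule nn_integral_mono)
        fix \<theta> :: "real^'n"
        have "\<bar>u x \<theta>\<bar> \<le> 1 + \<bar>u x \<theta>\<bar> powr r"
        proof (cases "\<bar>u x \<theta>\<bar> \<le> 1")
          case True
          then show ?thesis using powr_ge_zero[of "\<bar>u x \<theta>\<bar>" r] by linarith
        next
          case False
          then have "\<bar>u x \<theta>\<bar> powr 1 \<le> \<bar>u x \<theta>\<bar> powr r" using r by (intro powr_mono) auto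
          then show ?thesis using False by simp
        qed
        then have "ennreal \<bar>u x \<theta>\<bar> \<le> ennreal (1 + \<bar>u x \<theta>\<bar> powr r)" by (rule ennreal_leI)
        then show "ennreal \<bar>u x \<theta>\<bar> \<le> 1 + ennreal (\<bar>u x \<theta>\<bar> powr r)" by simp
      qed
      also have "\<dots> = emeasure sphere_measure (space (sphere_measure :: (real^'n) measure))
          + (\<integral>\<^sup>+\<theta>. ennreal (\<bar>u x \<theta>\<bar> powr r) \<partial>sphere_measure)"
        using m by (subst nn_integral_add) auto
      also have "\<dots> \<le> emeasure sphere_measure (space (sphere_measure :: (real^'n) measure)) + I"
      proof (rule add_left_mono)
        show "(\<integral>\<^sup>+\<theta>. ennreal (\<bar>u x \<theta>\<bar> powr r) \<partial>sphere_measure) \<le> I"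
          unfolding I_def
        proof (rule nn_integral_mono_AE)
          show "AE \<theta> in sphere_measure. ennreal (\<bar>u x \<theta>\<bar> powr r) \<le> ennreal (sup_norm X (\<lambda>x. u x \<theta>) powr r)"
            using Cb
          proof eventually_elim
            case (elim \<theta>)
            have "\<bar>u x \<theta>\<bar> \<le> sup_norm X (\<lambda>x. u x \<theta>)" by (rule abs_le_sup_norm[OF elim x])
            then show ?case using r by (intro ennreal_leI powr_mono2) auto
          qed
        qed
      qed
      finally have le: "(\<integral>\<^sup>+\<theta>. ennreal \<bar>u x \<theta>\<bar> \<partial>sphere_measure)
        \<le> emeasure (sphere_measure :: (real^'n) measure) (space sphere_measure) + I" .
      have fin: "emeasure (sphere_measure :: (real^'n) measure) (space sphere_measure) + I < \<infinity>"
        using I sphere.emeasure_finite by (auto simp: less_top[symmetric])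
      have int: "integrable sphere_measure (u x)"
        using meas[OF x] order_le_less_trans[OF le fin] by (simp add: integrable_iff_bounded)
      have "(\<integral>\<theta>. \<bar>u x \<theta>\<bar> \<partial>sphere_measure) = enn2real (\<integral>\<^sup>+\<theta>. ennreal \<bar>u x \<theta>\<bar> \<partial>sphere_measure)"
        using meas[OF x] by (intro integral_eq_nn_integral) auto
      also have "\<dots> \<le> B"
        unfolding B_def using le fin by (intro enn2real_mono) auto
      finally show ?thesis using int by simp
    qed
    obtain K where K0: "0 \<le> K"
      and K: "\<And>x \<theta> \<theta>'. x \<in> X \<Longrightarrow> \<theta> \<in> usphere \<Longrightarrow> \<theta>' \<in> usphere \<Longrightarrow> \<bar>k x \<theta> \<theta>'\<bar> \<le> K"
      using kernel_bounded by metis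
    have sc: "\<bar>scattering k u x \<theta>\<bar> \<le> K * B" if x: "x \<in> X" and \<theta>: "\<theta> \<in> usphere" for x \<theta>
    proof -
      have b: "AE \<theta>' in sphere_measure. \<bar>k x \<theta> \<theta>' * u x \<theta>'\<bar> \<le> K * \<bar>u x \<theta>'\<bar>"
        using AE_space
        by eventually_elim (use K[OF x \<theta>] in \<open>auto simp: space_sphere_measure abs_mult intro: mult_right_mono\<close>)
      have int: "integrable sphere_measure (\<lambda>\<theta>'. K * \<bar>u x \<theta>'\<bar>)"
        using L1[OF x] by (intro integrable_mult_right integrable_abs) auto
      have "integrable sphere_measure (\<lambda>\<theta>'. k x \<theta> \<theta>' * u x \<theta>')"
      proof (rule Bochner_Integration.integrable_bound[OF int])
        show "(\<lambda>\<theta>'. k x \<theta> \<theta>' * u x \<theta>') \<in> borel_measurable sphere_measure"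
          by (intro borel_measurable_times kernel_measurable[OF x \<theta>] meas[OF x])
        show "AE \<theta>' in sphere_measure. norm (k x \<theta> \<theta>' * u x \<theta>') \<le> norm (K * \<bar>u x \<theta>'\<bar>)"
          using b by eventually_elim simp
      qed
      then have "(\<integral>\<theta>'. \<bar>k x \<theta> \<theta>' * u x \<theta>'\<bar> \<partial>sphere_measure) \<le> (\<integral>\<theta>'. K * \<bar>u x \<theta>'\<bar> \<partial>sphere_measure)"
        using int b by (intro integral_mono_AE) auto
      also have "\<dots> \<le> K * B" using L1[OF x] K0 by (simp add: mult_left_mono)
      finally have "(\<integral>\<theta>'. \<bar>k x \<theta> \<theta>' * u x \<theta>'\<bar> \<partial>sphere_measure) \<le> K * B" .
      then show ?thesis
        unfolding scattering_def by (rule order_trans[OF integral_abs_bound])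
    qed
    have "AE \<theta> in sphere_measure. \<forall>x\<in>X. \<bar>f x + scattering k u x \<theta>\<bar> \<le> F + K * B"
      using AE_space
    proof eventually_elim
      case (elim \<theta>)
      show ?case
      proof
        fix x assume x: "x \<in> X"
        have "\<bar>scattering k u x \<theta>\<bar> \<le> K * B"
          using elim by (intro sc[OF x]) (simp add: space_sphere_measure)
        then show "\<bar>f x + scattering k u x \<theta>\<bar> \<le> F + K * B" using F[OF x] by linarith
      qed
    qed
    moreover have "AE \<theta> in sphere_measure. continuous_on X (\<lambda>x. u x \<theta>)"
      using Cb by eventually_elim (simp add: Cb_def)
    ultimately show ?thesis using forward_solution_le[OF sol] by blast
  qed
  then obtain C where "AE \<theta> in sphere_measure. \<forall>x\<in>X. \<bar>u x \<theta>\<bar> \<le> C" by blast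
  from *[OF this] show ?thesis by (rule that[rotated]) simp
qed

text \<open>If \<open>u\<close> is bounded by \<open>C\<close>, the characteristic estimate bounds it by \<open>diameter X * (F + \<rho> C)\<close>. As
  \<open>diameter X * \<rho> < 1\<close>, iterating this map from any starting bound converges to its fixed point, so the bound in the
  conclusion does not depend on \<open>C0\<close>.\<close>

lemma forward_solution_apriori:
  assumes sol: "forward_solution X \<sigma> k f u" and u: "ess_bounded_on X C0 u" and C0: "0 \<le> C0"
    and F: "\<And>x. x \<in> X \<Longrightarrow> \<bar>f x\<bar> \<le> F" "0 \<le> F" and sub: "diameter X * rho X k < 1"
  shows "ess_bounded_on X (diameter X * F / (1 - diameter X * rho X k)) u"
proof -
  define q where "q = diameter X * rho X k"
  define A where "A = diameter X * F / (1 - q)"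
  have d: "0 \<le> diameter X" by (rule diameter_ge_0[OF bounded_X])
  have q: "0 \<le> q" "q < 1" using d rho_nonneg sub by (auto simp: q_def)
  have A: "0 \<le> A" "diameter X * F + q * A = A"
    using d F(2) q by (auto simp: A_def field_simps)
  have iter: "ess_bounded_on X (A + q ^ n * C0) u" for n
  proof (induction n)
    case 0
    have "AE \<theta> in sphere_measure. continuous_on X (\<lambda>x. u x \<theta>) \<and> (\<forall>x\<in>X. \<bar>u x \<theta>\<bar> \<le> C0)"
      using u by (simp add: ess_bounded_on_def)
    then have "AE \<theta> in sphere_measure. continuous_on X (\<lambda>x. u x \<theta>) \<and> (\<forall>x\<in>X. \<bar>u x \<theta>\<bar> \<le> A + C0)"
      by eventually_elim (use A in force)
    then show ?case using u by (simp add: ess_bounded_on_def)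
  next
    case (Suc n)
    define C where "C = A + q ^ n * C0"
    have C: "0 \<le> C" using A q C0 by (simp add: C_def)
    have uC: "ess_bounded_on X C u" using Suc.IH by (simp add: C_def)
    have cont: "AE \<theta> in sphere_measure. continuous_on X (\<lambda>x. u x \<theta>)"
      using uC by (auto simp: ess_bounded_on_def)
    have "AE \<theta> in sphere_measure. \<forall>x\<in>X. \<bar>f x + scattering k u x \<theta>\<bar> \<le> F + C * rho X k"
      using AE_scattering_le[OF uC C]
    proof eventually_elim
      case (elim \<theta>)
      show ?case
      proof
        fix x assume x: "x \<in> X"
        show "\<bar>f x + scattering k u x \<theta>\<bar> \<le> F + C * rho X k"
          using F(1)[OF x] elim[rule_format, OF x] by linarith
      qed
    qed
    from forward_solution_le[OF sol cont this] cont
    have "AE \<theta> in sphere_measure. continuous_on X (\<lambda>x. u x \<theta>) \<and>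
        (\<forall>x\<in>X. \<bar>u x \<theta>\<bar> \<le> diameter X * (F + C * rho X k))"
      by eventually_elim auto
    moreover have "diameter X * (F + C * rho X k) = A + q ^ Suc n * C0"
    proof -
      have "diameter X * (F + C * rho X k) = diameter X * F + q * A + q * (q ^ n * C0)"
        by (simp add: C_def q_def algebra_simps)
      then show ?thesis using A(2) by (simp add: mult.assoc)
    qed
    ultimately show ?case using u by (simp add: ess_bounded_on_def)
  qed
  have "AE \<theta> in sphere_measure. \<forall>n. continuous_on X (\<lambda>x. u x \<theta>) \<and> (\<forall>x\<in>X. \<bar>u x \<theta>\<bar> \<le> A + q ^ n * C0)"
    unfolding AE_all_countable using iter by (simp add: ess_bounded_on_def)
  then have "AE \<theta> in sphere_measure. continuous_on X (\<lambda>x. u x \<theta>) \<and> (\<forall>x\<in>X. \<bar>u x \<theta>\<bar> \<le> A)"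
  proof eventually_elim
    case (elim \<theta>)
    have "(\<lambda>n. A + q ^ n * C0) \<longlonglongrightarrow> A + 0 * C0"
      using q by (intro tendsto_intros LIMSEQ_realpow_zero) auto
    then have "\<bar>u x \<theta>\<bar> \<le> A" if "x \<in> X" for x
      using elim that by (intro LIMSEQ_le_const[where X = "\<lambda>n. A + q ^ n * C0"]) auto
    then show ?case using elim by auto
  qed
  then show ?thesis using u by (simp add: ess_bounded_on_def A_def q_def)
qed

text \<open>Linearity of the equation. Splitting the scattering integral needs integrability,
  which is why the solutions are assumed essentially bounded.\<close>

lemma forward_solution_lincomb:
  assumes sol: "forward_solution X \<sigma> k f u" "forward_solution X \<sigma> k g w"
    and u: "ess_bounded_on X C u" and w: "ess_bounded_on X D w"
  shows "forward_solution X \<sigma> k (\<lambda>y. a * f y + b * g y) (\<lambda>x \<theta>. a * u x \<theta> + b * w x \<theta>)"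
  unfolding forward_solution_def
  using sol[unfolded forward_solution_def] AE_space
proof eventually_elim
  case (elim \<theta>)
  then have \<theta>: "\<theta> \<in> usphere" by (simp add: space_sphere_measure)
  show ?case
  proof (intro conjI ballI allI impI)
    fix x assume x: "x \<in> X"
    obtain D1 where D1: "((\<lambda>t. u (x + t *\<^sub>R \<theta>) \<theta>) has_real_derivative D1) (at 0)"
        "D1 + \<sigma> x * u x \<theta> - (\<integral>\<theta>'. k x \<theta> \<theta>' * u x \<theta>' \<partial>sphere_measure) = f x"
      using elim(1) x by blast
    obtain D2 where D2: "((\<lambda>t. w (x + t *\<^sub>R \<theta>) \<theta>) has_real_derivative D2) (at 0)"
        "D2 + \<sigma> x * w x \<theta> - (\<integral>\<theta>'. k x \<theta> \<theta>' * w x \<theta>' \<partial>sphere_measure) = g x"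
      using elim(2) x by blast
    have "(\<integral>\<theta>'. k x \<theta> \<theta>' * (a * u x \<theta>' + b * w x \<theta>') \<partial>sphere_measure)
        = (\<integral>\<theta>'. a * (k x \<theta> \<theta>' * u x \<theta>') + b * (k x \<theta> \<theta>' * w x \<theta>') \<partial>sphere_measure)"
      by (simp add: algebra_simps)
    also have "\<dots> = a * (\<integral>\<theta>'. k x \<theta> \<theta>' * u x \<theta>' \<partial>sphere_measure)
        + b * (\<integral>\<theta>'. k x \<theta> \<theta>' * w x \<theta>' \<partial>sphere_measure)"
      using kernel_mult_integrable[OF u x \<theta>] kernel_mult_integrable[OF w x \<theta>] by simp
    finally have int: "(\<integral>\<theta>'. k x \<theta> \<theta>' * (a * u x \<theta>' + b * w x \<theta>') \<partial>sphere_measure) = \<dots>" .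
    have "((\<lambda>t. a * u (x + t *\<^sub>R \<theta>) \<theta> + b * w (x + t *\<^sub>R \<theta>) \<theta>) has_real_derivative a * D1 + b * D2) (at 0)"
      by (intro DERIV_add DERIV_cmult D1 D2)
    moreover have "a * D1 + b * D2 + \<sigma> x * (a * u x \<theta> + b * w x \<theta>) -
        (\<integral>\<theta>'. k x \<theta> \<theta>' * (a * u x \<theta>' + b * w x \<theta>') \<partial>sphere_measure) = a * f x + b * g x"
      unfolding int D1(2)[symmetric] D2(2)[symmetric] by (simp add: algebra_simps)
    ultimately show "\<exists>D. ((\<lambda>t. a * u (x + t *\<^sub>R \<theta>) \<theta> + b * w (x + t *\<^sub>R \<theta>) \<theta>) has_real_derivative D) (at 0) \<and>
        D + \<sigma> x * (a * u x \<theta> + b * w x \<theta>) -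
        (\<integral>\<theta>'. k x \<theta> \<theta>' * (a * u x \<theta>' + b * w x \<theta>') \<partial>sphere_measure) = a * f x + b * g x"
      by blast
  next
    fix y assume y: "(y, \<theta>) \<in> Gamma_minus X"
    have "((\<lambda>t. a * u (y + t *\<^sub>R \<theta>) \<theta> + b * w (y + t *\<^sub>R \<theta>) \<theta>) \<longlongrightarrow> a * 0 + b * 0) (at_right 0)"
      using elim(1,2) y by (intro tendsto_intros) auto
    then show "((\<lambda>t. a * u (y + t *\<^sub>R \<theta>) \<theta> + b * w (y + t *\<^sub>R \<theta>) \<theta>) \<longlongrightarrow> 0) (at_right 0)"
      by simp
  qed
qed

end

section \<open>The operators of the inverse problem\<close>

context transport_medium
begin

lemma A_op_eq: "A_op \<sigma> k u x \<theta> = scattering k u x \<theta> - \<sigma> x * u x \<theta>"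
  by (simp add: A_op_def scattering_def)

lemma A_op_measurable:
  assumes u: "ess_bounded_on X C u" and x: "x \<in> X"
  shows "A_op \<sigma> k u x \<in> borel_measurable sphere_measure"
proof -
  have c: "continuous_on usphere (\<lambda>\<theta>. (x, \<theta>))" by (intro continuous_intros)
  have "(\<lambda>\<theta>. (x, \<theta>)) ` usphere \<subseteq> X \<times> usphere" using x by auto
  from continuous_on_compose2[OF scattering_continuous[OF u] c this]
  have "continuous_on usphere (\<lambda>\<theta>. scattering k u x \<theta>)" by simp
  then have "(\<lambda>\<theta>. scattering k u x \<theta>) \<in> borel_measurable sphere_measure"
    by (rule continuous_on_sphere_measurable)
  then have "(\<lambda>\<theta>. scattering k u x \<theta> - \<sigma> x * u x \<theta>) \<in> borel_measurable sphere_measure"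
    using ess_bounded_on_AE(1)[OF u x]
    by (intro borel_measurable_diff borel_measurable_times borel_measurable_const)
  then show ?thesis unfolding A_op_eq[abs_def] .
qed

lemma AE_A_op:
  assumes u: "ess_bounded_on X C u" and C: "0 \<le> C"
  shows "AE \<theta> in sphere_measure. continuous_on X (\<lambda>x. A_op \<sigma> k u x \<theta>) \<and>
    (\<forall>x\<in>X. \<bar>A_op \<sigma> k u x \<theta>\<bar> \<le> (sup_norm X \<sigma> + rho X k) * C)"
proof -
  have ae: "AE \<theta> in sphere_measure. continuous_on X (\<lambda>x. u x \<theta>) \<and> (\<forall>x\<in>X. \<bar>u x \<theta>\<bar> \<le> C)"
    using u by (simp add: ess_bounded_on_def)
  show ?thesis
    using ae AE_scattering_le[OF u C] AE_space
  proof eventually_elim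
    case (elim \<theta>)
    have c: "continuous_on X (\<lambda>x. (x, \<theta>))" by (intro continuous_intros)
    have "(\<lambda>x. (x, \<theta>)) ` X \<subseteq> X \<times> usphere" using elim(3) by (auto simp: space_sphere_measure)
    from continuous_on_compose2[OF scattering_continuous[OF u] c this]
    have "continuous_on X (\<lambda>x. scattering k u x \<theta>)" by simp
    moreover have "continuous_on X \<sigma>"
      using sigma_cont closure_subset by (rule continuous_on_subset)
    ultimately have "continuous_on X (\<lambda>x. A_op \<sigma> k u x \<theta>)"
      unfolding A_op_eq using elim(1) by (intro continuous_intros) auto
    moreover have "\<bar>A_op \<sigma> k u x \<theta>\<bar> \<le> (sup_norm X \<sigma> + rho X k) * C" if x: "x \<in> X" for x
    proof -
      have "\<bar>\<sigma> x * u x \<theta>\<bar> \<le> sup_norm X \<sigma> * C"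
        using sigma_bounded[OF x] elim(1) x order_trans[OF abs_ge_zero sigma_bounded[OF x]]
        by (auto simp: abs_mult intro!: mult_mono)
      moreover have "\<bar>scattering k u x \<theta>\<bar> \<le> C * rho X k" using elim(2) x by blast
      ultimately show ?thesis unfolding A_op_eq by (simp add: algebra_simps)
    qed
    ultimately show ?case by blast
  qed
qed

end

text \<open>The weight \<open>v\<close> plays the part of the adjoint solution; \<open>V\<close> and \<open>I\<close> stand for its supremum and for the
  infimum of its integral over the directions.\<close>

locale weighted_medium = transport_medium X \<sigma> k
  for X :: "(real^'n) set" and \<sigma> k +
  fixes v :: "real^'n \<Rightarrow> real^'n \<Rightarrow> real" and V I :: real
  assumes v_cont: "continuous_on (X \<times> usphere) (\<lambda>(x, \<theta>). v x \<theta>)"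
    and v_bound: "x \<in> X \<Longrightarrow> \<theta> \<in> usphere \<Longrightarrow> \<bar>v x \<theta>\<bar> \<le> V"
    and V_nonneg: "0 \<le> V"
    and I_pos: "0 < I" and I_le: "x \<in> X \<Longrightarrow> I \<le> (\<integral>\<theta>. v x \<theta> \<partial>sphere_measure)"
begin

lemma v_measurable: "x \<in> X \<Longrightarrow> v x \<in> borel_measurable sphere_measure"
proof (rule continuous_on_sphere_measurable)
  assume x: "x \<in> X"
  have c: "continuous_on usphere (\<lambda>\<theta>. (x, \<theta>))" by (intro continuous_intros)
  have "(\<lambda>\<theta>. (x, \<theta>)) ` usphere \<subseteq> X \<times> usphere" using x by auto
  from continuous_on_compose2[OF v_cont c this]
  show "continuous_on usphere (v x)" by simp
qed

lemma AE_v: "AE \<theta> in sphere_measure. continuous_on X (\<lambda>x. v x \<theta>) \<and> (\<forall>x\<in>X. \<bar>v x \<theta>\<bar> \<le> V)"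
  using AE_space
proof eventually_elim
  case (elim \<theta>)
  then have \<theta>: "\<theta> \<in> usphere" by (simp add: space_sphere_measure)
  have c: "continuous_on X (\<lambda>x. (x, \<theta>))" by (intro continuous_intros)
  have "(\<lambda>x. (x, \<theta>)) ` X \<subseteq> X \<times> usphere" using \<theta> by auto
  from continuous_on_compose2[OF v_cont c this]
  show ?case using v_bound \<theta> by simp
qed

lemma v_integrable: "x \<in> X \<Longrightarrow> integrable sphere_measure (v x)"
proof (rule sphere.integrable_const_bound)
  assume "x \<in> X"
  then show "AE \<theta> in sphere_measure. norm (v x \<theta>) \<le> V"
    by (intro eventually_mono[OF AE_v]) simp
qed (rule v_measurable)

lemma K_op_integrand_measurable:
  assumes "ess_bounded_on X C u" "x \<in> X"
  shows "(\<lambda>\<theta>. A_op \<sigma> k u x \<theta> * v x \<theta>) \<in> borel_measurable sphere_measure"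
  by (intro borel_measurable_times A_op_measurable[OF assms] v_measurable[OF assms(2)])

lemma AE_K_op_integrand:
  assumes u: "ess_bounded_on X C u" and C: "0 \<le> C"
  shows "AE \<theta> in sphere_measure. continuous_on X (\<lambda>x. A_op \<sigma> k u x \<theta> * v x \<theta>) \<and>
    (\<forall>x\<in>X. \<bar>A_op \<sigma> k u x \<theta> * v x \<theta>\<bar> \<le> V * ((sup_norm X \<sigma> + rho X k) * C))"
  using AE_A_op[OF u C] AE_v
proof eventually_elim
  case (elim \<theta>)
  have "\<bar>A_op \<sigma> k u x \<theta> * v x \<theta>\<bar> \<le> V * ((sup_norm X \<sigma> + rho X k) * C)" if x: "x \<in> X" for x
  proof -
    have "\<bar>v x \<theta>\<bar> * \<bar>A_op \<sigma> k u x \<theta>\<bar> \<le> V * ((sup_norm X \<sigma> + rho X k) * C)"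
      using elim x V_nonneg by (intro mult_mono) auto
    then show ?thesis by (simp add: abs_mult mult.commute)
  qed
  then show ?case using elim by (auto intro!: continuous_intros)
qed

lemma M_op_K_op_le:
  assumes u: "ess_bounded_on X C u" and C: "0 \<le> C" and x: "x \<in> X"
  shows "\<bar>M_op v (K_op \<sigma> k v u) x\<bar>
    \<le> V * ((sup_norm X \<sigma> + rho X k) * C) * measure (sphere_measure :: (real^'n) measure) usphere / I"
proof -
  have "AE \<theta> in sphere_measure. \<bar>A_op \<sigma> k u x \<theta> * v x \<theta>\<bar> \<le> V * ((sup_norm X \<sigma> + rho X k) * C)"
    using AE_K_op_integrand[OF u C] by eventually_elim (use x in blast)
  from sphere.abs_integral_le_const[OF K_op_integrand_measurable[OF u x] this]
  have "\<bar>K_op \<sigma> k v u x\<bar>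
      \<le> V * ((sup_norm X \<sigma> + rho X k) * C) * measure (sphere_measure :: (real^'n) measure) usphere"
    by (simp add: K_op_def space_sphere_measure)
  then show ?thesis
    unfolding M_op_def using I_pos I_le[OF x] by (auto simp: abs_div intro!: frac_le)
qed

lemma M_op_K_op_continuous:
  assumes u: "ess_bounded_on X C u" and C: "0 \<le> C"
  shows "continuous_on X (M_op v (K_op \<sigma> k v u))"
proof -
  have "continuous_on X (\<lambda>x. \<integral>\<theta>. v x \<theta> \<partial>sphere_measure)"
    by (rule sphere.continuous_on_parameter_integral[OF v_measurable AE_v])
  moreover have "continuous_on X (\<lambda>x. \<integral>\<theta>. A_op \<sigma> k u x \<theta> * v x \<theta> \<partial>sphere_measure)"
    by (rule sphere.continuous_on_parameter_integral[OF K_op_integrand_measurable[OF u] AE_K_op_integrand[OF u C]])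
  moreover have "\<forall>x\<in>X. (\<integral>\<theta>. v x \<theta> \<partial>sphere_measure) \<noteq> 0" using I_pos I_le by force
  ultimately have "continuous_on X (\<lambda>x. (\<integral>\<theta>. A_op \<sigma> k u x \<theta> * v x \<theta> \<partial>sphere_measure) / (\<integral>\<theta>. v x \<theta> \<partial>sphere_measure))"
    by (intro continuous_on_divide)
  then show ?thesis by (simp add: M_op_def[abs_def] K_op_def)
qed

lemma K_op_integrable:
  assumes u: "ess_bounded_on X C u" and C: "0 \<le> C" and x: "x \<in> X"
  shows "integrable sphere_measure (\<lambda>\<theta>. A_op \<sigma> k u x \<theta> * v x \<theta>)"
proof (rule sphere.integrable_const_bound)
  show "AE \<theta> in sphere_measure. norm (A_op \<sigma> k u x \<theta> * v x \<theta>) \<le> V * ((sup_norm X \<sigma> + rho X k) * C)"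
    using AE_K_op_integrand[OF u C] by eventually_elim (use x in auto)
qed (rule K_op_integrand_measurable[OF u x])

lemma M_op_K_op_lincomb:
  assumes u: "ess_bounded_on X C u" and w: "ess_bounded_on X D w" and C: "0 \<le> C" "0 \<le> D" and x: "x \<in> X"
  shows "M_op v (K_op \<sigma> k v (\<lambda>x \<theta>. a * u x \<theta> + b * w x \<theta>)) x
    = a * M_op v (K_op \<sigma> k v u) x + b * M_op v (K_op \<sigma> k v w) x"
proof -
  have A: "A_op \<sigma> k (\<lambda>x \<theta>. a * u x \<theta> + b * w x \<theta>) x \<theta> = a * A_op \<sigma> k u x \<theta> + b * A_op \<sigma> k w x \<theta>"
    if \<theta>: "\<theta> \<in> usphere" for \<theta>
  proof -
    have "scattering k (\<lambda>x \<theta>. a * u x \<theta> + b * w x \<theta>) x \<theta>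
        = (\<integral>\<theta>'. a * (k x \<theta> \<theta>' * u x \<theta>') + b * (k x \<theta> \<theta>' * w x \<theta>') \<partial>sphere_measure)"
      by (simp add: scattering_def algebra_simps)
    also have "\<dots> = a * scattering k u x \<theta> + b * scattering k w x \<theta>"
      using kernel_mult_integrable[OF u x \<theta>] kernel_mult_integrable[OF w x \<theta>]
      by (simp add: scattering_def)
    finally show ?thesis by (simp add: A_op_eq algebra_simps)
  qed
  have "K_op \<sigma> k v (\<lambda>x \<theta>. a * u x \<theta> + b * w x \<theta>) x
      = (\<integral>\<theta>. a * (A_op \<sigma> k u x \<theta> * v x \<theta>) + b * (A_op \<sigma> k w x \<theta> * v x \<theta>) \<partial>sphere_measure)"
    unfolding K_op_def
    by (intro Bochner_Integration.integral_cong refl) (simp add: space_sphere_measure A algebra_simps)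
  also have "\<dots> = a * K_op \<sigma> k v u x + b * K_op \<sigma> k v w x"
    using K_op_integrable[OF u C(1) x] K_op_integrable[OF w C(2) x] by (simp add: K_op_def)
  finally show ?thesis by (simp add: M_op_def add_divide_distrib)
qed

text \<open>The double integral and the absorption integral in the functional combine to \<open>K_op\<close>, and
  the isotropic source leaves the integral over \<open>\<theta>\<close>. Division by the angular integral of \<open>v\<close> gives the equation
  \<open>M H = S + (M \<circ> K \<circ> Sol) S\<close> that the Neumann series inverts.\<close>

lemma M_op_internal_functional:
  assumes u: "ess_bounded_on X C u" and C: "0 \<le> C" and x: "x \<in> X"
  shows "M_op v (internal_functional \<sigma> k S v u) x = S x + M_op v (K_op \<sigma> k v u) x"
proof -
  have int1: "integrable sphere_measure (\<lambda>\<theta>. \<sigma> x * u x \<theta> * v x \<theta>)"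
  proof (rule sphere.integrable_const_bound)
    show "AE \<theta> in sphere_measure. norm (\<sigma> x * u x \<theta> * v x \<theta>) \<le> \<bar>\<sigma> x\<bar> * C * V"
      using ess_bounded_on_AE(2)[OF u x] AE_v
    proof eventually_elim
      case (elim \<theta>)
      then show ?case using x C V_nonneg by (auto simp: abs_mult intro!: mult_mono)
    qed
    show "(\<lambda>\<theta>. \<sigma> x * u x \<theta> * v x \<theta>) \<in> borel_measurable sphere_measure"
      by (intro borel_measurable_times borel_measurable_const ess_bounded_on_AE(1)[OF u x] v_measurable[OF x])
  qed
  have "integrable sphere_measure (\<lambda>\<theta>. A_op \<sigma> k u x \<theta> * v x \<theta> + \<sigma> x * u x \<theta> * v x \<theta>)"
    using K_op_integrable[OF u C x] int1 by (rule Bochner_Integration.integrable_add)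
  then have int2: "integrable sphere_measure (\<lambda>\<theta>. scattering k u x \<theta> * v x \<theta>)"
    by (simp add: A_op_eq algebra_simps)
  have sc: "(\<integral>\<theta>'. k x \<theta> \<theta>' * v x \<theta> * u x \<theta>' \<partial>sphere_measure) = scattering k u x \<theta> * v x \<theta>" for \<theta>
  proof -
    have "(\<integral>\<theta>'. k x \<theta> \<theta>' * v x \<theta> * u x \<theta>' \<partial>sphere_measure)
        = (\<integral>\<theta>'. (k x \<theta> \<theta>' * u x \<theta>') * v x \<theta> \<partial>sphere_measure)"
      by (simp add: mult_ac)
    also have "\<dots> = scattering k u x \<theta> * v x \<theta>"
      unfolding scattering_def by (rule integral_mult_left_zero)
    finally show ?thesis .
  qed
  have "K_op \<sigma> k v u x = (\<integral>\<theta>. scattering k u x \<theta> * v x \<theta> - \<sigma> x * u x \<theta> * v x \<theta> \<partial>sphere_measure)"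
    by (simp add: K_op_def A_op_eq left_diff_distrib)
  also have "\<dots> = (\<integral>\<theta>. scattering k u x \<theta> * v x \<theta> \<partial>sphere_measure)
      - (\<integral>\<theta>. \<sigma> x * u x \<theta> * v x \<theta> \<partial>sphere_measure)"
    using int2 int1 by (rule Bochner_Integration.integral_diff)
  finally have "internal_functional \<sigma> k S v u x
      = S x * (\<integral>\<theta>. v x \<theta> \<partial>sphere_measure) + K_op \<sigma> k v u x"
    by (simp add: internal_functional_def sc)
  moreover have "(\<integral>\<theta>. v x \<theta> \<partial>sphere_measure) \<noteq> 0" using I_pos I_le[OF x] by force
  ultimately show ?thesis by (simp add: M_op_def add_divide_distrib)
qed

end

section \<open>Reconstruction of the source\<close>

theorem theorem3:
  fixes X :: "(real^'n) set"
    and \<sigma> S :: "real^'n \<Rightarrow> real"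
    and k :: "real^'n \<Rightarrow> real^'n \<Rightarrow> real^'n \<Rightarrow> real"
    and f0 :: "(real^'n) \<times> (real^'n) \<Rightarrow> real"
    and v0 :: "real^'n \<Rightarrow> real^'n \<Rightarrow> real"
    and p :: ennreal
    and Sol :: "(real^'n \<Rightarrow> real) \<Rightarrow> real^'n \<Rightarrow> real^'n \<Rightarrow> real"
  assumes dim: "CARD('n) \<ge> 2"
    and domain: "open X" "bounded X" "X \<noteq> {}" "smooth_boundary X"
    and sigma_cont: "continuous_on (closure X) \<sigma>"
    and sigma_pos: "\<exists>c>0. \<forall>x\<in>closure X. \<sigma> x \<ge> c"
    and k_cont: "continuous_on (closure X \<times> usphere \<times> usphere) (\<lambda>(x, \<theta>, \<theta>'). k x \<theta> \<theta>')"
    and k_pos: "\<exists>c>0. \<forall>x\<in>closure X. \<forall>\<theta>\<in>usphere. \<forall>\<theta>'\<in>usphere. k x \<theta> \<theta>' \<ge> c"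
    and k_rot: "rotation_invariant (closure X) k"
    and S_cont: "continuous_on (closure X) S"
    and A2: "(\<exists>\<alpha>>0. (INF x\<in>closure X. \<sigma> x) - rho X k \<ge> \<alpha>) \<or> diameter X * rho X k < 1"
    and p: "1 \<le> p"
    and Sol: "\<And>f. f \<in> Cb X \<Longrightarrow> Sol f \<in> LpC p X \<and> forward_solution X \<sigma> k f (Sol f)"
    and f0_cont: "continuous_on (Gamma_plus X) f0"
    and f0_pos: "\<exists>c>0. \<forall>z\<in>Gamma_plus X. f0 z \<ge> c"
    and v0_sol: "adjoint_solution X \<sigma> k f0 v0"
    and v0_bdd: "bounded ((\<lambda>(x, \<theta>). v0 x \<theta>) ` (X \<times> usphere))"
    and v0_pos: "\<exists>c>0. \<forall>x\<in>X. (\<forall>\<theta>\<in>usphere. v0 x \<theta> \<ge> c) \<and> (\<integral>\<theta>. v0 x \<theta> \<partial>sphere_measure) \<ge> c"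
    and subcritical: "diameter X * rho X k < 1"
    and small: "sup_norm (X \<times> usphere) (\<lambda>(x, \<theta>). v0 x \<theta>) * (sup_norm X \<sigma> + rho X k) *
        diameter X * measure sphere_measure (usphere :: (real^'n) set) /
        ((1 - diameter X * rho X k) * (INF x\<in>X. \<integral>\<theta>. v0 x \<theta> \<partial>sphere_measure)) < 1"
  shows "contraction_C X (M_op v0 \<circ> K_op \<sigma> k v0 \<circ> Sol) \<and>
    uniform_limit X
      (\<lambda>N x. \<Sum>j<N. ((\<lambda>f y. - (M_op v0 \<circ> K_op \<sigma> k v0 \<circ> Sol) f y) ^^ j)
                     (M_op v0 (internal_functional \<sigma> k S v0 (Sol S))) x)
      S sequentially"
proof -
  define V where "V = sup_norm (X \<times> usphere) (\<lambda>(x, \<theta>). v0 x \<theta>)"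
  define I where "I = (INF x\<in>X. \<integral>\<theta>. v0 x \<theta> \<partial>sphere_measure)"
  define T where "T = M_op v0 \<circ> K_op \<sigma> k v0 \<circ> Sol"
  obtain x0 where x0: "x0 \<in> X" using domain(3) by blast
  obtain c where c: "c > 0" "\<And>x. x \<in> X \<Longrightarrow> c \<le> (\<integral>\<theta>. v0 x \<theta> \<partial>sphere_measure)"
    using v0_pos by blast
  have v0_cont: "continuous_on (X \<times> usphere) (\<lambda>(x, \<theta>). v0 x \<theta>)"
    using v0_sol unfolding adjoint_solution_def by (blast intro: continuous_on_subset)
  have v0_Cb: "(\<lambda>(x, \<theta>). v0 x \<theta>) \<in> Cb (X \<times> usphere)"
    using v0_cont v0_bdd by (simp add: Cb_def)
  have V: "\<bar>v0 x \<theta>\<bar> \<le> V" if "x \<in> X" "\<theta> \<in> usphere" for x \<theta>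
    using abs_le_sup_norm[OF v0_Cb, of "(x, \<theta>)"] that by (simp add: V_def)
  interpret weighted_medium X \<sigma> k v0 V I
  proof
    show "open X" "bounded X" "smooth_boundary X" by fact+
    show "continuous_on (closure X) \<sigma>" by fact
    show "0 \<le> \<sigma> x" if "x \<in> closure X" for x using sigma_pos that by force
    show "continuous_on (closure X \<times> usphere \<times> usphere) (\<lambda>(x, \<theta>, \<theta>'). k x \<theta> \<theta>')" by fact
    show "0 \<le> k x \<theta> \<theta>'" if "x \<in> closure X" "\<theta> \<in> usphere" "\<theta>' \<in> usphere" for x \<theta> \<theta>'
      using k_pos that by (meson less_imp_le order_trans)
    show "continuous_on (X \<times> usphere) (\<lambda>(x, \<theta>). v0 x \<theta>)" by (rule v0_cont)
    show "\<bar>v0 x \<theta>\<bar> \<le> V" if "x \<in> X" "\<theta> \<in> usphere" for x \<theta> using that by (rule V)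
    have "axis undefined 1 \<in> (usphere :: (real^'n) set)" by (simp add: norm_axis_1)
    then show "0 \<le> V" using order_trans[OF abs_ge_zero V[OF x0]] by blast
    have "c \<le> I" unfolding I_def using c(2) domain(3) by (intro cINF_greatest) auto
    then show "0 < I" using c(1) by simp
    show "I \<le> (\<integral>\<theta>. v0 x \<theta> \<partial>sphere_measure)" if "x \<in> X" for x
      unfolding I_def using c(2) that by (intro cINF_lower bdd_belowI2) auto
  qed
  have d: "0 \<le> diameter X" by (rule diameter_ge_0[OF bounded_X])
  define G where "G = diameter X / (1 - diameter X * rho X k)"
  have G: "0 \<le> G" using d subcritical by (simp add: G_def)
  have bdd: "\<exists>C\<ge>0. ess_bounded_on X C (Sol f)" if f: "f \<in> Cb X" for f
    using ess_bounded_of_LpC[of f "Sol f" p "sup_norm X f"] Sol[OF f] p abs_le_sup_norm[OF f] by metis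
  have Sol_le: "ess_bounded_on X (G * F) (Sol f)"
    if f: "f \<in> Cb X" and F: "\<And>x. x \<in> X \<Longrightarrow> \<bar>f x\<bar> \<le> F" for f F
  proof -
    have "0 \<le> F" using F[OF x0] by simp
    moreover obtain C where "0 \<le> C" "ess_bounded_on X C (Sol f)" using bdd[OF f] by blast
    ultimately show ?thesis
      using forward_solution_apriori[of f "Sol f" C F] Sol[OF f] F subcritical by (simp add: G_def)
  qed
  have T_eq: "T f x = M_op v0 (K_op \<sigma> k v0 (Sol f)) x" for f x by (simp add: T_def)
  \<comment> \<open>The left-hand side of the smallness assumption.\<close>
  define q where "q = V * ((sup_norm X \<sigma> + rho X k) * G) * measure (sphere_measure :: (real^'n) measure) usphere / I"
  have q1: "q < 1"
    using small by (simp add: q_def V_def[symmetric] I_def[symmetric] G_def mult_ac)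
  have T_le: "\<bar>T f x\<bar> \<le> q * F"
    if f: "f \<in> Cb X" and F: "\<And>x. x \<in> X \<Longrightarrow> \<bar>f x\<bar> \<le> F" and x: "x \<in> X" for f F x
  proof -
    have "0 \<le> F" using F[OF x0] by simp
    then have "0 \<le> G * F" using G by simp
    from M_op_K_op_le[OF Sol_le[OF f F] this x] show ?thesis
      by (simp add: T_eq q_def mult_ac)
  qed
  have T_Cb: "T f \<in> Cb X" if f: "f \<in> Cb X" for f
  proof (rule CbI)
    obtain C where "0 \<le> C" "ess_bounded_on X C (Sol f)" using bdd[OF f] by blast
    then have "continuous_on X (M_op v0 (K_op \<sigma> k v0 (Sol f)))"
      by (intro M_op_K_op_continuous)
    then show "continuous_on X (T f)" by (simp add: T_def)
    show "\<bar>T f x\<bar> \<le> q * sup_norm X f" if "x \<in> X" for x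
      using f abs_le_sup_norm[OF f] that by (rule T_le)
  qed
  have T_lin: "T (\<lambda>y. a * f y + b * g y) x = a * T f x + b * T g x"
    if f: "f \<in> Cb X" and g: "g \<in> Cb X" and x: "x \<in> X" for f g a b x
  proof -
    define h where "h = (\<lambda>y. a * f y + b * g y)"
    define w where "w = (\<lambda>x \<theta>. a * Sol f x \<theta> + b * Sol g x \<theta>)"
    \<comment> \<open>Linearity is uniqueness: \<open>z\<close> is a bounded solution without source, so the a priori bound makes it vanish.\<close>
    define z where "z = (\<lambda>x \<theta>. 1 * Sol h x \<theta> + (-1) * w x \<theta>)"
    have h: "h \<in> Cb X" unfolding h_def by (rule Cb_lincomb[OF f g])
    obtain C where C: "0 \<le> C" "ess_bounded_on X C (Sol f)" using bdd[OF f] by blast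
    obtain D where D: "0 \<le> D" "ess_bounded_on X D (Sol g)" using bdd[OF g] by blast
    obtain E where E: "0 \<le> E" "ess_bounded_on X E (Sol h)" using bdd[OF h] by blast
    define W where "W = \<bar>a\<bar> * C + \<bar>b\<bar> * D"
    have W: "0 \<le> W" "ess_bounded_on X W w"
      unfolding W_def w_def using C D by (auto intro: ess_bounded_on_lincomb)
    have z_bdd: "ess_bounded_on X (\<bar>1\<bar> * E + \<bar>-1\<bar> * W) z"
      unfolding z_def by (rule ess_bounded_on_lincomb[OF E(2) W(2)])
    have "forward_solution X \<sigma> k h w"
      unfolding h_def w_def using Sol f g C(2) D(2) by (blast intro: forward_solution_lincomb)
    then have "forward_solution X \<sigma> k (\<lambda>y. 1 * h y + (-1) * h y) z"
      unfolding z_def using Sol[OF h] E(2) W(2) by (blast intro: forward_solution_lincomb)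
    from forward_solution_apriori[OF this z_bdd _ _ _ subcritical, of 0]
    have "ess_bounded_on X 0 z" using E W by simp
    from M_op_K_op_le[OF this _ x] have "M_op v0 (K_op \<sigma> k v0 z) x = 0" by simp
    moreover have "M_op v0 (K_op \<sigma> k v0 z) x = 1 * T h x + (-1) * M_op v0 (K_op \<sigma> k v0 w) x"
      unfolding z_def T_eq by (rule M_op_K_op_lincomb[OF E(2) W(2) E(1) W(1) x])
    moreover have "M_op v0 (K_op \<sigma> k v0 w) x = a * T f x + b * T g x"
      unfolding w_def T_eq by (rule M_op_K_op_lincomb[OF C(2) D(2) C(1) D(1) x])
    ultimately show ?thesis by (simp add: h_def)
  qed
  have "op_norm_C X T \<le> ereal q"
    unfolding op_norm_C_def
  proof (rule SUP_least)
    fix f assume "f \<in> {f \<in> Cb X. sup_norm X f \<le> 1}"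
    then have f: "f \<in> Cb X" "\<And>x. x \<in> X \<Longrightarrow> \<bar>f x\<bar> \<le> 1"
      using abs_le_sup_norm by force+
    have "sup_norm X (T f) \<le> q"
      using T_le[OF f] domain(3) by (intro sup_norm_le) auto
    then show "ereal (sup_norm X (T f)) \<le> ereal q" by simp
  qed
  also have "\<dots> < 1" using q1 by simp
  finally have contr: "contraction_C X T"
    using T_Cb T_lin by (simp add: contraction_C_def)
  have S: "S \<in> Cb X"
  proof -
    have "bounded (S ` closure X)"
      using bounded_X S_cont by (intro compact_imp_bounded compact_continuous_image) auto
    then show ?thesis
      using S_cont closure_subset[of X]
      by (auto simp: Cb_def intro: continuous_on_subset bounded_subset)
  qed
  obtain C where "0 \<le> C" "ess_bounded_on X C (Sol S)" using bdd[OF S] by blast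
  then have "M_op v0 (internal_functional \<sigma> k S v0 (Sol S)) x = S x + T S x" if "x \<in> X" for x
    using that unfolding T_eq by (intro M_op_internal_functional)
  from neumann_series_C[OF contr S this] contr show ?thesis
    unfolding T_def by blast
qed

end
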